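(* Let $\mathfrak{e}\subset\mathbb{C}$ be a compact (not necessarily connected) simply connected set which is regular for potential theory, let $G_{\mathfrak{e}}$ be its Green's function, and for $\alpha>0$ let $\mathfrak{e}^\alpha=\{z\in\mathbb{C} : G_{\mathfrak{e}}(z)=\alpha\}$. Then for each $n$ the map $\alpha\mapsto\mathcal{W}_n(\mathfrak{e}^\alpha)$ is monotone decreasing in $\alpha$, i.e. $\mathcal{W}_n(\mathfrak{e}^\beta)\le\mathcal{W}_n(\mathfrak{e}^\alpha)$ whenever $0<\alpha\le\beta$. In particular, if $\mathfrak{e}$ obeys a Totik--Widom bound $t_n^{(\mathfrak{e})}\le Q\,C(\mathfrak{e})^n$ for all $n$, with some constant $Q$, then for each $\alpha>0$ the set $\mathfrak{e}^\alpha$ obeys $t_n^{(\mathfrak{e}^\alpha)}\le Q\,C(\mathfrak{e}^\alpha)^n$ for all $n$ (i.e. a Totik--Widom bound with the same or smaller constant).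
   Context: For a compact, not finite, set $\mathfrak{e}\subset\mathbb{C}$, $\|f\|_{\mathfrak{e}}=\sup_{z\in\mathfrak{e}}|f(z)|$; the Chebyshev polynomial $T_n^{(\mathfrak{e})}$ is the unique monic polynomial of degree $n$ minimizing $\|P\|_{\mathfrak{e}}$ over all monic polynomials $P$ of degree $n$, and $t_n^{(\mathfrak{e})}=\|T_n^{(\mathfrak{e})}\|_{\mathfrak{e}}$. $C(\mathfrak{e})$ is the logarithmic capacity and $\mathcal{W}_n(\mathfrak{e})=t_n^{(\mathfrak{e})}/C(\mathfrak{e})^n$. A compact set $\mathfrak{e}$ is called simply connected if $\mathbb{C}\setminus\mathfrak{e}$ is connected. $G_{\mathfrak{e}}$ is the Green's function, with pole at infinity, of the unbounded component of $\mathbb{C}\setminus\mathfrak{e}$, set to $0$ on $\mathfrak{e}$; $\mathfrak{e}$ is regular for potential theory if it has positive capacity and $G_{\mathfrak{e}}(z)\to0$ as $z$ approaches any boundary point of this component. *)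

theory Defs
  imports
    "HOL-Probability.Probability_Measure"
    "HOL-Computational_Algebra.Polynomial"
    "HOL-Library.Landau_Symbols"
begin

definition sup_norm :: "complex set \<Rightarrow> (complex \<Rightarrow> complex) \<Rightarrow> real" where
  "sup_norm e f = (SUP z\<in>e. cmod (f z))"

text \<open>For compact infinite sets the minimizer exists and is unique, so \<open>arg_min\<close> selects the
  Chebyshev polynomial.\<close>

definition chebyshev_poly :: "complex set \<Rightarrow> nat \<Rightarrow> complex poly" where
  "chebyshev_poly e n =
     arg_min (\<lambda>P. sup_norm e (poly P)) (\<lambda>P. degree P = n \<and> lead_coeff P = 1)"

definition chebyshev_norm :: "complex set \<Rightarrow> nat \<Rightarrow> real" where
  "chebyshev_norm e n = sup_norm e (poly (chebyshev_poly e n))"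

text \<open>The logarithmic kernel is \<open>\<infinity>\<close> on the diagonal; this is spelled out because \<open>ln 0 = 0\<close>.\<close>

definition log_kernel :: "complex \<Rightarrow> complex \<Rightarrow> ereal" where
  "log_kernel z w = (if z = w then \<infinity> else ereal (- ln (cmod (z - w))))"

text \<open>The energy is the double integral of the kernel, as the integral of the positive part minus
  that of the negative part (\<open>e2ennreal\<close> maps negative numbers to \<open>0\<close>). For measures of compact
  support the negative part has a finite integral, so the difference is well defined.\<close>

definition log_energy :: "complex measure \<Rightarrow> ereal" where
  "log_energy \<mu> =
     enn2ereal (\<integral>\<^sup>+ z. \<integral>\<^sup>+ w. e2ennreal (log_kernel z w) \<partial>\<mu> \<partial>\<mu>) -
     enn2ereal (\<integral>\<^sup>+ z. \<integral>\<^sup>+ w. e2ennreal (- log_kernel z w) \<partial>\<mu> \<partial>\<mu>)"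

definition prob_measures_on :: "complex set \<Rightarrow> complex measure set" where
  "prob_measures_on e = {\<mu>. prob_space \<mu> \<and> sets \<mu> = sets borel \<and> emeasure \<mu> e = 1}"

definition min_log_energy :: "complex set \<Rightarrow> ereal" where
  "min_log_energy e = (INF \<mu>\<in>prob_measures_on e. log_energy \<mu>)"

text \<open>Logarithmic capacity of a compact set. The minimal energy is never \<open>-\<infinity>\<close> there, and it is
  \<open>\<infinity>\<close> for the empty set.\<close>

definition log_capacity :: "complex set \<Rightarrow> real" where
  "log_capacity e =
     (if min_log_energy e = \<infinity> then 0 else exp (- real_of_ereal (min_log_energy e)))"

definition widom_factor :: "complex set \<Rightarrow> nat \<Rightarrow> real" where
  "widom_factor e n = chebyshev_norm e n / log_capacity e ^ n"

definition totik_widom_bound :: "complex set \<Rightarrow> real \<Rightarrow> bool" where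
  "totik_widom_bound e Q \<longleftrightarrow> (\<forall>n. chebyshev_norm e n \<le> Q * log_capacity e ^ n)"

definition borel_polar :: "complex set \<Rightarrow> bool" where
  "borel_polar N \<longleftrightarrow> N \<in> sets borel \<and> (\<forall>K\<subseteq>N. compact K \<longrightarrow> log_capacity K = 0)"

text \<open>Twice continuously differentiable (in the real sense) with vanishing Laplacian;
  \<open>ux\<close>, \<open>uxy\<close> etc. are the partial derivatives.\<close>

definition harmonic_function_on :: "complex set \<Rightarrow> (complex \<Rightarrow> real) \<Rightarrow> bool" where
  "harmonic_function_on S u \<longleftrightarrow> open S \<and>
     (\<exists>ux uy uxx uxy uyx uyy :: complex \<Rightarrow> real.
        continuous_on S uxx \<and> continuous_on S uxy \<and> continuous_on S uyx \<and> continuous_on S uyy \<and>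
        (\<forall>z\<in>S. (u has_derivative (\<lambda>h. ux z * Re h + uy z * Im h)) (at z) \<and>
               (ux has_derivative (\<lambda>h. uxx z * Re h + uxy z * Im h)) (at z) \<and>
               (uy has_derivative (\<lambda>h. uyx z * Re h + uyy z * Im h)) (at z) \<and>
               uxx z + uyy z = 0))"

text \<open>\<open>G\<close> is the Green's function, with pole at infinity, of the unbounded component
  \<open>outside e\<close> of the complement of the compact set \<open>e\<close>, extended by \<open>0\<close>. For a general
  set of positive capacity the boundary values are attained only up to a polar set.\<close>

definition is_green_function :: "complex set \<Rightarrow> (complex \<Rightarrow> real) \<Rightarrow> bool" where
  "is_green_function e G \<longleftrightarrow>
     harmonic_function_on (outside e) G \<and>
     (\<forall>R. bounded (G ` (outside e \<inter> ball 0 R))) \<and>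
     (\<lambda>z. G z - ln (cmod z)) \<in> O[at_infinity](\<lambda>_. 1) \<and>
     (\<exists>N. borel_polar N \<and>
        (\<forall>\<zeta>\<in>frontier (outside e) - N. (G \<longlongrightarrow> 0) (at \<zeta> within outside e))) \<and>
     (\<forall>z. z \<notin> outside e \<longrightarrow> G z = 0)"

text \<open>Compact sets of positive capacity have exactly one Green's function, so the quantifier over
  \<open>G\<close> only names it.\<close>

definition potential_regular :: "complex set \<Rightarrow> bool" where
  "potential_regular e \<longleftrightarrow> 0 < log_capacity e \<and>
     (\<forall>G. is_green_function e G \<longrightarrow>
        (\<forall>\<zeta>\<in>frontier (outside e). (G \<longlongrightarrow> 0) (at \<zeta> within outside e)))"

end

theory Submission
  imports Defs
    "HOL-Computational_Algebra.Fundamental_Theorem_Algebra"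
    "HOL-Real_Asymp.Real_Asymp"
    "HOL-Probability.Helly_Selection"
begin

text \<open>
  Write \<open>L\<^sub>\<alpha>\<close> for the level curve \<open>{z. G z = \<alpha>}\<close>. The quotient of two Widom factors compares two
  things: how fast the Chebyshev norms grow from one level to the next, and how fast the capacity
  does.

  Chebyshev norms. If \<open>P\<close> is monic of degree \<open>n\<close> and \<open>\<bar>P\<bar> \<le> M\<close> on \<open>L\<^sub>\<alpha>\<close>, then
  \<open>ln \<bar>P\<bar> - n (G - \<alpha>)\<close> is subharmonic where \<open>G > \<alpha>\<close> and bounded above near infinity, so the maximum
  principle gives the Bernstein--Walsh inequality \<open>\<bar>P\<bar> \<le> M exp (n (\<beta> - \<alpha>))\<close> on \<open>L\<^sub>\<beta>\<close>
  (\<open>bernstein_walsh\<close>). Hence the Chebyshev norm grows at most by the factor \<open>exp (n (\<beta> - \<alpha>))\<close>.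
  The same holds with \<open>e\<close> and \<open>0\<close> in place of \<open>L\<^sub>\<alpha>\<close> and \<open>\<alpha>\<close>.

  Capacities. There is a number \<open>\<tau>\<close> such that \<open>L\<^sub>\<alpha>\<close> has capacity exactly \<open>exp (\<tau> + \<alpha>)\<close> for all
  \<open>\<alpha> > 0\<close>, while \<open>e\<close> has capacity at most \<open>exp \<tau>\<close>; so the capacity grows exactly by
  the factor \<open>exp (\<beta> - \<alpha>)\<close>, and both claims follow. The number \<open>\<tau>\<close> is defined by the
  smallest growth rate of monic polynomials on level curves. As capacity is defined by energies of
  measures, the formula needs two bounds.

  \<^item> Upper bound (\<open>capacity_sublevel_le\<close>). Let \<open>\<alpha> < \<beta>\<close>. For every probability
    weight on finitely many points \<open>x\<close> of \<open>K = {z. G z \<le> \<alpha>}\<close> the weighted mean of \<open>ln \<bar>w - x\<bar>\<close>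
    is at most \<open>\<tau> + \<beta>\<close> for some \<open>w\<close> on \<open>L\<^sub>\<beta>\<close>, by the maximum principle again. This is one side of a
    two-person game, and its other side is a product \<open>P\<close> of linear factors with roots on \<open>L\<^sub>\<beta>\<close>
    that satisfies \<open>\<bar>P\<bar> \<le> exp (N (\<tau> + \<beta> + \<epsilon>))\<close>
    on all of \<open>K\<close>; the multiplicative weights method constructs it. Small monic polynomials
    bound the product of the mutual distances of any points of \<open>K\<close> by Lagrange interpolation, and a
    measure of smaller energy would contain points that violate this bound
    (\<open>ex_finite_set_small_energy\<close>).

  \<^item> Lower bound (\<open>log_capacity_ge_of_point_sequence\<close>). By definition of \<open>\<tau>\<close>, every monic
    polynomial of degree \<open>n\<close> reaches modulus \<open>exp (n (\<tau> + \<alpha>))\<close> on \<open>L\<^sub>\<alpha>\<close>. Choosing each new point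
    where the product of the distances to the earlier points is that large yields a Leja sequence,
    and a weak limit of its counting measures has energy at most \<open>- (\<tau> + \<alpha>)\<close>. The points are
    first lifted to \<open>[0, 1]\<close> through a continuous space-filling curve, so that the weak limit
    exists by Helly's theorem for measures on the real line.
\<close>

section \<open>Functions with vanishing Laplacian and the maximum principle\<close>

text \<open>Only second derivatives along the two coordinate directions at a single point enter
  the maximum principle. A pointwise Laplacian built from them is closed under sums and applies
  equally to \<open>G\<close>, to \<open>ln \<bar>z - x\<bar>\<close> and to \<open>\<bar>z\<bar>\<^sup>2\<close>.\<close>

definition has_second_derivative_at_0 :: "(real \<Rightarrow> real) \<Rightarrow> real \<Rightarrow> bool" where
  "has_second_derivative_at_0 f a \<longleftrightarrow>
     (\<exists>g. (\<forall>\<^sub>F t in nhds 0. (f has_real_derivative g t) (at t)) \<and>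
          (g has_real_derivative a) (at 0))"

definition has_laplacian :: "(complex \<Rightarrow> real) \<Rightarrow> real \<Rightarrow> complex \<Rightarrow> bool" where
  "has_laplacian v L z \<longleftrightarrow>
     (\<exists>a b. has_second_derivative_at_0 (\<lambda>t. v (z + of_real t)) a \<and>
            has_second_derivative_at_0 (\<lambda>t. v (z + of_real t * \<i>)) b \<and> a + b = L)"

lemma has_second_derivative_at_0_add:
  assumes "has_second_derivative_at_0 f a" "has_second_derivative_at_0 g b"
  shows "has_second_derivative_at_0 (\<lambda>t. f t + g t) (a + b)"
proof -
  obtain f' where f: "\<forall>\<^sub>F t in nhds 0. (f has_real_derivative f' t) (at t)"
      "(f' has_real_derivative a) (at 0)"
    using assms(1) unfolding has_second_derivative_at_0_def by blast
  obtain g' where g: "\<forall>\<^sub>F t in nhds 0. (g has_real_derivative g' t) (at t)"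
      "(g' has_real_derivative b) (at 0)"
    using assms(2) unfolding has_second_derivative_at_0_def by blast
  have "\<forall>\<^sub>F t in nhds 0. ((\<lambda>t. f t + g t) has_real_derivative f' t + g' t) (at t)"
    using f(1) g(1) by eventually_elim (rule DERIV_add)
  moreover have "((\<lambda>t. f' t + g' t) has_real_derivative a + b) (at 0)"
    using f(2) g(2) by (rule DERIV_add)
  ultimately show ?thesis unfolding has_second_derivative_at_0_def
    by (intro exI[of _ "\<lambda>t. f' t + g' t"]) simp
qed

lemma has_second_derivative_at_0_cmult:
  assumes "has_second_derivative_at_0 f a"
  shows "has_second_derivative_at_0 (\<lambda>t. c * f t) (c * a)"
proof -
  obtain f' where f: "\<forall>\<^sub>F t in nhds 0. (f has_real_derivative f' t) (at t)"
      "(f' has_real_derivative a) (at 0)"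
    using assms(1) unfolding has_second_derivative_at_0_def by blast
  have "\<forall>\<^sub>F t in nhds 0. ((\<lambda>t. c * f t) has_real_derivative c * f' t) (at t)"
    using f(1) by eventually_elim (rule DERIV_cmult)
  moreover have "((\<lambda>t. c * f' t) has_real_derivative c * a) (at 0)"
    using f(2) by (rule DERIV_cmult)
  ultimately show ?thesis unfolding has_second_derivative_at_0_def
    by (intro exI[of _ "\<lambda>t. c * f' t"]) simp
qed

lemma has_laplacian_add:
  assumes "has_laplacian u L z" "has_laplacian v M z"
  shows "has_laplacian (\<lambda>z. u z + v z) (L + M) z"
proof -
  obtain a b where 1: "has_second_derivative_at_0 (\<lambda>t. u (z + of_real t)) a"
      "has_second_derivative_at_0 (\<lambda>t. u (z + of_real t * \<i>)) b" "a + b = L"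
    using assms(1) unfolding has_laplacian_def by blast
  obtain c d where 2: "has_second_derivative_at_0 (\<lambda>t. v (z + of_real t)) c"
      "has_second_derivative_at_0 (\<lambda>t. v (z + of_real t * \<i>)) d" "c + d = M"
    using assms(2) unfolding has_laplacian_def by blast
  show ?thesis unfolding has_laplacian_def
    using has_second_derivative_at_0_add[OF 1(1) 2(1)]
      has_second_derivative_at_0_add[OF 1(2) 2(2)] 1(3) 2(3)
    by (intro exI[of _ "a + c"] exI[of _ "b + d"]) auto
qed

lemma has_laplacian_cmult:
  assumes "has_laplacian u L z"
  shows "has_laplacian (\<lambda>z. c * u z) (c * L) z"
proof -
  obtain a b where 1: "has_second_derivative_at_0 (\<lambda>t. u (z + of_real t)) a"
      "has_second_derivative_at_0 (\<lambda>t. u (z + of_real t * \<i>)) b" "a + b = L"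
    using assms(1) unfolding has_laplacian_def by blast
  show ?thesis unfolding has_laplacian_def
    using has_second_derivative_at_0_cmult[OF 1(1), of c]
      has_second_derivative_at_0_cmult[OF 1(2), of c] 1(3)
    by (intro exI[of _ "c * a"] exI[of _ "c * b"]) (auto simp: algebra_simps)
qed

lemma has_laplacian_const: "has_laplacian (\<lambda>z. c) 0 z"
proof -
  have "has_second_derivative_at_0 (\<lambda>t. c) 0"
    unfolding has_second_derivative_at_0_def by (intro exI[of _ "\<lambda>_. 0"]) auto
  then show ?thesis unfolding has_laplacian_def by force
qed

lemma has_laplacian_sum:
  assumes "finite I" "\<And>i. i \<in> I \<Longrightarrow> has_laplacian (u i) 0 z"
  shows "has_laplacian (\<lambda>z. \<Sum>i\<in>I. u i z) 0 z"
  using assms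
proof (induction I rule: finite_induct)
  case (insert i I)
  then show ?case
    using has_laplacian_add[of "u i" 0 z "\<lambda>z. \<Sum>i\<in>I. u i z" 0] by auto
qed (auto simp: has_laplacian_const)

lemma has_laplacian_cong:
  assumes "\<forall>\<^sub>F w in nhds z. u w = v w"
  shows "has_laplacian u L z \<longleftrightarrow> has_laplacian v L z"
proof -
  have lim: "((\<lambda>t. z + of_real t * d) \<longlongrightarrow> z) (nhds 0)" for d
  proof -
    have "((\<lambda>t. z + of_real t * d) \<longlongrightarrow> z + of_real 0 * d) (nhds 0)"
      by (intro tendsto_intros filterlim_ident)
    then show ?thesis by simp
  qed
  have *: "has_second_derivative_at_0 f a \<longleftrightarrow> has_second_derivative_at_0 g a"
    if "\<forall>\<^sub>F t in nhds 0. f t = g t" for f g a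
  proof -
    have "\<forall>\<^sub>F t in nhds 0. \<forall>\<^sub>F s in nhds t. f s = g s"
      using that by (simp add: eventually_eventually)
    then have "\<forall>\<^sub>F t in nhds 0. \<forall>d. (f has_real_derivative d) (at t) \<longleftrightarrow> (g has_real_derivative d) (at t)"
      by eventually_elim (intro allI DERIV_cong_ev, auto)
    then show ?thesis unfolding has_second_derivative_at_0_def
      by (smt (verit, ccfv_SIG) eventually_elim2)
  qed
  show ?thesis unfolding has_laplacian_def
    using *[OF eventually_compose_filterlim[OF assms lim[of 1]]]
      *[OF eventually_compose_filterlim[OF assms lim[of \<i>]]] by simp
qed

lemma has_laplacian_norm_square: "has_laplacian (\<lambda>z. (cmod z)\<^sup>2) 4 z"
proof -
  have "has_second_derivative_at_0 (\<lambda>t. (cmod (z + of_real t))\<^sup>2) 2"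
    unfolding has_second_derivative_at_0_def cmod_power2
    by (intro exI[of _ "\<lambda>t. 2 * (Re z + t)"]) (auto intro!: derivative_eq_intros always_eventually)
  moreover have "has_second_derivative_at_0 (\<lambda>t. (cmod (z + of_real t * \<i>))\<^sup>2) 2"
    unfolding has_second_derivative_at_0_def cmod_power2
    by (intro exI[of _ "\<lambda>t. 2 * (Im z + t)"]) (auto intro!: derivative_eq_intros always_eventually)
  ultimately show ?thesis unfolding has_laplacian_def by force
qed

lemma has_second_derivative_ln_norm:
  fixes p q :: real
  assumes "p\<^sup>2 + q\<^sup>2 \<noteq> 0"
  shows "has_second_derivative_at_0 (\<lambda>t. ln (sqrt ((p + t)\<^sup>2 + q\<^sup>2)))
           ((q\<^sup>2 - p\<^sup>2) / (p\<^sup>2 + q\<^sup>2)\<^sup>2)"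
proof -
  have pos0: "p\<^sup>2 + q\<^sup>2 > 0"
    using assms by (metis add_nonneg_nonneg less_eq_real_def zero_le_power2)
  have "((\<lambda>t. (p + t)\<^sup>2 + q\<^sup>2) \<longlongrightarrow> (p + 0)\<^sup>2 + q\<^sup>2) (nhds 0)"
    by (intro tendsto_intros filterlim_ident)
  then have "((\<lambda>t. (p + t)\<^sup>2 + q\<^sup>2) \<longlongrightarrow> p\<^sup>2 + q\<^sup>2) (nhds 0)" by simp
  then have ev: "\<forall>\<^sub>F t in nhds 0. (p + t)\<^sup>2 + q\<^sup>2 > 0"
    using pos0 by (rule order_tendstoD)
  have D: "((\<lambda>t. ln (sqrt ((p + t)\<^sup>2 + q\<^sup>2))) has_real_derivative (p + t) / ((p + t)\<^sup>2 + q\<^sup>2)) (at t)"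
    if "(p + t)\<^sup>2 + q\<^sup>2 > 0" for t
    using that
    by (auto intro!: derivative_eq_intros simp: field_simps power2_eq_square real_sqrt_mult[symmetric])
  have "\<forall>\<^sub>F t in nhds 0. ((\<lambda>t. ln (sqrt ((p + t)\<^sup>2 + q\<^sup>2))) has_real_derivative
          (p + t) / ((p + t)\<^sup>2 + q\<^sup>2)) (at t)"
    using ev by eventually_elim (rule D)
  moreover have "((\<lambda>t. (p + t) / ((p + t)\<^sup>2 + q\<^sup>2)) has_real_derivative
      (q\<^sup>2 - p\<^sup>2) / (p\<^sup>2 + q\<^sup>2)\<^sup>2) (at 0)"
    using assms by (auto intro!: derivative_eq_intros simp: power2_eq_square)
  ultimately show ?thesis unfolding has_second_derivative_at_0_def
    by (intro exI[of _ "\<lambda>t. (p + t) / ((p + t)\<^sup>2 + q\<^sup>2)"] conjI)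
qed

lemma has_laplacian_ln_norm:
  assumes "z \<noteq> x"
  shows "has_laplacian (\<lambda>z. ln (cmod (z - x))) 0 z"
proof -
  define p q where "p = Re (z - x)" and "q = Im (z - x)"
  have nz: "p\<^sup>2 + q\<^sup>2 \<noteq> 0" "q\<^sup>2 + p\<^sup>2 \<noteq> 0"
    using assms by (auto simp: p_def q_def complex_eq_iff sum_power2_eq_zero_iff)
  have 1: "cmod (z + of_real t - x) = sqrt ((p + t)\<^sup>2 + q\<^sup>2)" for t
    by (simp add: cmod_def p_def q_def algebra_simps)
  have 2: "cmod (z + of_real t * \<i> - x) = sqrt ((q + t)\<^sup>2 + p\<^sup>2)" for t
    by (simp add: cmod_def p_def q_def algebra_simps)
  show ?thesis unfolding has_laplacian_def 1 2
    using has_second_derivative_ln_norm[OF nz(1)] has_second_derivative_ln_norm[OF nz(2)]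
    by (intro exI[of _ "(q\<^sup>2 - p\<^sup>2) / (p\<^sup>2 + q\<^sup>2)\<^sup>2"] exI[of _ "(p\<^sup>2 - q\<^sup>2) / (q\<^sup>2 + p\<^sup>2)\<^sup>2"])
      (auto simp: add.commute diff_divide_distrib)
qed

lemma harmonic_function_on_has_laplacian:
  assumes "harmonic_function_on S u" "z \<in> S"
  shows "has_laplacian u 0 z"
proof -
  obtain ux uy uxx uxy uyx uyy where S: "open S" and
    D: "\<And>z. z \<in> S \<Longrightarrow> (u has_derivative (\<lambda>h. ux z * Re h + uy z * Im h)) (at z)"
       "\<And>z. z \<in> S \<Longrightarrow> (ux has_derivative (\<lambda>h. uxx z * Re h + uxy z * Im h)) (at z)"
       "\<And>z. z \<in> S \<Longrightarrow> (uy has_derivative (\<lambda>h. uyx z * Re h + uyy z * Im h)) (at z)"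
       "\<And>z. z \<in> S \<Longrightarrow> uxx z + uyy z = 0"
    using assms(1) unfolding harmonic_function_on_def by blast
  have line: "((\<lambda>t. v (z + of_real t * d)) has_real_derivative (a * Re d + b * Im d)) (at t)"
    if "(v has_derivative (\<lambda>h. a * Re h + b * Im h)) (at (z + of_real t * d))"
    for v a b t d
  proof -
    have "((\<lambda>t. z + of_real t * d) has_derivative (\<lambda>h. of_real h * d)) (at t)"
      by (auto intro!: derivative_eq_intros)
    from has_derivative_compose[OF this that]
    have "((\<lambda>t. v (z + of_real t * d)) has_derivative (\<lambda>h. a * Re (of_real h * d) + b * Im (of_real h * d))) (at t)" .
    moreover have "(\<lambda>h. a * Re (of_real h * d) + b * Im (of_real h * d)) = (*) (a * Re d + b * Im d)"
      by (auto simp: algebra_simps fun_eq_iff)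
    ultimately show ?thesis by (simp add: has_field_derivative_def)
  qed
  have ev: "\<forall>\<^sub>F t in nhds 0. z + of_real t * d \<in> S" for d
  proof -
    have "((\<lambda>t. z + of_real t * d) \<longlongrightarrow> z + of_real 0 * d) (nhds 0)"
      by (intro tendsto_intros filterlim_ident)
    then show ?thesis using S assms(2) by (auto simp: tendsto_def)
  qed
  have "has_second_derivative_at_0 (\<lambda>t. u (z + of_real t * 1)) (uxx z)"
    unfolding has_second_derivative_at_0_def
  proof (intro exI[of _ "\<lambda>t. ux (z + of_real t * 1)"] conjI)
    show "\<forall>\<^sub>F t in nhds 0. ((\<lambda>t. u (z + of_real t * 1)) has_real_derivative ux (z + of_real t * 1)) (at t)"
      using ev[of 1] by eventually_elim (use line[OF D(1), of _ 1] in auto)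
    show "((\<lambda>t. ux (z + of_real t * 1)) has_real_derivative uxx z) (at 0)"
      using line[of ux "uxx z" "uxy z" 0 1] D(2)[OF assms(2)] by simp
  qed
  moreover have "has_second_derivative_at_0 (\<lambda>t. u (z + of_real t * \<i>)) (uyy z)"
    unfolding has_second_derivative_at_0_def
  proof (intro exI[of _ "\<lambda>t. uy (z + of_real t * \<i>)"] conjI)
    show "\<forall>\<^sub>F t in nhds 0. ((\<lambda>t. u (z + of_real t * \<i>)) has_real_derivative uy (z + of_real t * \<i>)) (at t)"
      using ev[of \<i>] by eventually_elim (use line[OF D(1), of _ \<i>] in auto)
    show "((\<lambda>t. uy (z + of_real t * \<i>)) has_real_derivative uyy z) (at 0)"
      using line[of uy "uyx z" "uyy z" 0 \<i>] D(3)[OF assms(2)] by simp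
  qed
  ultimately show ?thesis unfolding has_laplacian_def using D(4)[OF assms(2)] by auto
qed

text \<open>At a maximum the first derivative vanishes; a positive second derivative would make
  it positive just to the right, so that the function increases there.\<close>

lemma second_derivative_nonpos_at_local_max:
  assumes "has_second_derivative_at_0 f a" "\<forall>\<^sub>F t in nhds 0. f t \<le> f 0"
  shows "a \<le> 0"
proof (rule ccontr)
  assume "\<not> a \<le> 0"
  then have a: "a > 0" by simp
  obtain g where g: "\<forall>\<^sub>F t in nhds 0. (f has_real_derivative g t) (at t)"
      "(g has_real_derivative a) (at 0)"
    using assms(1) unfolding has_second_derivative_at_0_def by blast
  have "\<forall>\<^sub>F t in nhds 0. (f has_real_derivative g t) (at t) \<and> f t \<le> f 0"
    using g(1) assms(2) by eventually_elim simp
  then obtain d where d: "d > 0" "\<And>t. \<bar>t\<bar> < d \<Longrightarrow> (f has_real_derivative g t) (at t) \<and> f t \<le> f 0"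
    unfolding eventually_nhds_metric by (auto simp: dist_real_def)
  have g0: "g 0 = 0"
    using DERIV_local_max[of f "g 0" 0 d] d by auto
  obtain d' where d': "d' > 0" "\<And>h. 0 < h \<Longrightarrow> h < d' \<Longrightarrow> g 0 < g (0 + h)"
    using DERIV_pos_inc_right[OF g(2) a] by auto
  define t where "t = min d d' / 2"
  have t: "0 < t" "t < d" "t < d'" using d(1) d'(1) by (auto simp: t_def min_def)
  obtain z where z: "0 < z" "z < t" "f t - f 0 = (t - 0) * g z"
    using MVT2[of 0 t f g] t d(2) by (metis abs_of_nonneg order_le_less_trans)
  have "g z > 0" using d'(2)[of z] z t g0 by auto
  then have "f t > f 0" using z t by (simp add: algebra_simps)
  then show False using d(2)[of t] t by auto
qed

lemma no_local_max_of_positive_laplacian: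
  assumes "has_laplacian v L z" "L > 0"
  shows "\<not> (\<forall>\<^sub>F w in nhds z. v w \<le> v z)"
proof
  assume ev: "\<forall>\<^sub>F w in nhds z. v w \<le> v z"
  obtain a b where ab: "has_second_derivative_at_0 (\<lambda>t. v (z + of_real t)) a"
      "has_second_derivative_at_0 (\<lambda>t. v (z + of_real t * \<i>)) b" "a + b = L"
    using assms(1) unfolding has_laplacian_def by blast
  have lim: "((\<lambda>t. z + of_real t * d) \<longlongrightarrow> z) (nhds 0)" for d
  proof -
    have "((\<lambda>t. z + of_real t * d) \<longlongrightarrow> z + of_real 0 * d) (nhds 0)"
      by (intro tendsto_intros filterlim_ident)
    then show ?thesis by simp
  qed
  have "\<forall>\<^sub>F t in nhds 0. v (z + of_real t * d) \<le> v (z + of_real 0 * d)" for d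
    using eventually_compose_filterlim[OF ev lim[of d]] by simp
  from second_derivative_nonpos_at_local_max[OF ab(1)] second_derivative_nonpos_at_local_max[OF ab(2)]
    this[of 1] this[of \<i>]
  show False using ab(3) assms(2) by auto
qed

text \<open>The maximum principle for \<open>ln F\<close>, phrased through \<open>F \<ge> 0\<close> so that zeros of a polynomial factor
  of \<open>F\<close> need no separate treatment. If the bound failed at \<open>z\<close>, the function
  \<open>F exp (d \<bar>w\<bar>\<^sup>2)\<close> with small \<open>d > 0\<close> would still have an interior maximum, although its logarithm
  has Laplacian \<open>4 d > 0\<close> there.\<close>

lemma maximum_principle:
  fixes F :: "complex \<Rightarrow> real"
  assumes S: "closed S" and op: "open (S - B)" and BS: "B \<subseteq> S"
    and cont: "continuous_on S F" and nonneg: "\<And>z. z \<in> S \<Longrightarrow> F z \<ge> 0"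
    and lap: "\<And>z. z \<in> S - B \<Longrightarrow> F z > 0 \<Longrightarrow> has_laplacian (\<lambda>z. ln (F z)) 0 z"
    and inf: "(F \<longlongrightarrow> 0) at_infinity"
    and bd: "\<And>z. z \<in> B \<Longrightarrow> F z \<le> M"
    and z: "z \<in> S" and M: "M \<ge> 0"
  shows "F z \<le> M"
proof (rule ccontr)
  assume "\<not> F z \<le> M"
  then have zM: "F z > M" by simp
  define M' where "M' = (M + F z) / 2"
  have M': "M < M'" "M' < F z" "M' > 0" using zM M by (auto simp: M'_def)
  have "\<forall>\<^sub>F w in at_infinity. F w < M'" using inf M'(3) by (rule order_tendstoD)
  then obtain R0 where R0: "\<And>w. cmod w \<ge> R0 \<Longrightarrow> F w < M'"
    unfolding eventually_at_infinity by blast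
  define R where "R = max R0 (cmod z + 1)"
  have R: "R > cmod z" "\<And>w. cmod w \<ge> R \<Longrightarrow> F w < M'"
    using R0 by (auto simp: R_def less_max_iff_disj)
  have R1: "R \<ge> 1" using norm_ge_zero[of z] unfolding R_def by linarith
  \<comment> \<open>The perturbation must not lift any value below \<open>M'\<close>, taken inside the disc of radius \<open>R\<close>,
    up to \<open>F z\<close>.\<close>
  define d where "d = ln (F z / M') / (2 * R\<^sup>2)"
  have d0: "d > 0" using M' R1 by (simp add: d_def)
  have "d * R\<^sup>2 = ln (F z / M') / 2" using R1 by (simp add: d_def)
  also have "\<dots> < ln (F z / M')" using M' by simp
  finally have "d * R\<^sup>2 < ln (F z / M')" .
  then have dR: "M' * exp (d * R\<^sup>2) < F z"
    using M' by (metis exp_less_cancel_iff exp_ln divide_pos_pos mult.commute order.strict_trans pos_less_divide_eq)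
  define H where "H w = F w * exp (d * (cmod w)\<^sup>2)" for w
  define C where "C = S \<inter> cball 0 R"
  have C: "compact C" "z \<in> C"
    using S R(1) z by (auto simp: C_def closed_Int_compact)
  have "continuous_on C H" unfolding H_def C_def
    by (intro continuous_intros continuous_on_subset[OF cont]) auto
  then obtain w where w: "w \<in> C" "\<And>y. y \<in> C \<Longrightarrow> H y \<le> H w"
    using continuous_attains_sup[OF C(1)] C(2) by (metis empty_iff)
  have "F z \<le> H z" using nonneg[OF z] d0 by (simp add: H_def mult_le_cancel_left1)
  also have "\<dots> \<le> H w" using w C(2) by simp
  finally have Hw: "F z \<le> H w" .
  have small: "H w < F z" if "F w < M'"
  proof -
    have "H w \<le> M' * exp (d * R\<^sup>2)" unfolding H_def
      using that w(1) d0 nonneg[of w] by (intro mult_mono) (auto simp: C_def power_mono)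
    then show ?thesis using dR by simp
  qed
  have FwM: "F w \<ge> M'" using small Hw by force
  then have "w \<notin> B" using bd[of w] M'(1) by force
  moreover have "cmod w < R" using R(2)[of w] FwM by force
  ultimately have wi: "w \<in> (S - B) \<inter> ball 0 R" using w(1) by (auto simp: C_def)
  have opi: "open ((S - B) \<inter> ball 0 R)" using op by auto
  have Fw: "F w > 0" using FwM M' by simp
  have Fpos: "\<forall>\<^sub>F y in nhds w. F y > 0"
  proof -
    have "continuous_on (S - B) F" using cont continuous_on_subset by blast
    then have "isCont F w" using op wi continuous_on_eq_continuous_at by blast
    then have "(F \<longlongrightarrow> F w) (nhds w)"
      by (simp add: continuous_at tendsto_at_iff_tendsto_nhds)
    then show ?thesis using Fw by (rule order_tendstoD)
  qed
  have "\<forall>\<^sub>F y in nhds w. y \<in> (S - B) \<inter> ball 0 R"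
    using opi wi by (rule eventually_nhds_in_open)
  then have mx: "\<forall>\<^sub>F y in nhds w. ln (F y) + d * (cmod y)\<^sup>2 \<le> ln (F w) + d * (cmod w)\<^sup>2"
    using Fpos
  proof eventually_elim
    case (elim y)
    have "H y \<le> H w" using w(2)[of y] elim by (auto simp: C_def)
    then have "ln (H y) \<le> ln (H w)" using elim Fw by (simp add: H_def)
    then show ?case using elim Fw by (simp add: H_def ln_mult)
  qed
  have "has_laplacian (\<lambda>y. ln (F y) + d * (cmod y)\<^sup>2) (0 + d * 4) w"
    by (intro has_laplacian_add has_laplacian_cmult lap has_laplacian_norm_square)
      (use wi Fw in auto)
  from no_local_max_of_positive_laplacian[OF this] d0 mx show False by simp
qed

section \<open>Growth of potentials and polynomials along the level curves\<close>

lemma monic_poly_eq_prod_roots: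
  fixes P :: "complex poly"
  assumes "degree P = n" "lead_coeff P = 1"
  obtains a :: "nat \<Rightarrow> complex" where "\<And>z. poly P z = (\<Prod>i<n. z - a i)"
proof -
  have "P \<noteq> 0" using assms(2) by auto
  from alg_closed_imp_factorization[OF this]
  obtain A where A: "size A = degree P" "P = smult (lead_coeff P) (\<Prod>x\<in>#A. [:-x, 1:])"
    by (elim exE conjE)
  obtain xs where xs: "mset xs = A" using ex_mset by blast
  have "poly (\<Prod>x\<in>#B. [:-x, 1:]) z = (\<Prod>x\<in>#B. z - x)" for B :: "complex multiset" and z
    by (induction B) (auto simp: algebra_simps)
  then have "poly P z = (\<Prod>x\<in>#mset xs. z - x)" for z
    using A(2) assms(2) xs by (metis smult_1_left)
  moreover have "(\<Prod>x\<in>#mset xs. z - x) = prod_list (map (\<lambda>x. z - x) xs)" for z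
    by (metis mset_map prod_mset_prod_list)
  moreover have "prod_list (map (\<lambda>x. z - x) xs) = (\<Prod>i<n. z - xs ! i)" for z
    using A(1) assms(1) xs by (subst prod.list_conv_set_nth) (auto simp: atLeast0LessThan)
  ultimately have "poly P z = (\<Prod>i<n. z - xs ! i)" for z by simp
  then show ?thesis by (rule that)
qed

lemma prod_roots_monic_poly:
  fixes a :: "nat \<Rightarrow> complex"
  obtains P :: "complex poly" where "degree P = n" "lead_coeff P = 1"
    "\<And>z. poly P z = (\<Prod>i<n. z - a i)"
proof
  let ?P = "\<Prod>i<n. [:- a i, 1:]"
  show "degree ?P = n" by (subst degree_prod_eq_sum_degree) auto
  show "lead_coeff ?P = 1" by (subst lead_coeff_prod) auto
  show "poly ?P z = (\<Prod>i<n. z - a i)" for z by (simp add: poly_prod)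
qed

lemma ln_norm_diff_at_infinity:
  "((\<lambda>z. ln (cmod (z - x)) - ln (cmod z)) \<longlongrightarrow> 0) at_infinity"
proof -
  have "((\<lambda>z. x / z) \<longlongrightarrow> 0) at_infinity"
    by (intro tendsto_divide_0[OF tendsto_const] filterlim_ident)
  then have "((\<lambda>z. ln (cmod (1 - x / z))) \<longlongrightarrow> ln (cmod (1 - 0))) at_infinity"
    by (intro tendsto_intros) auto
  then have "((\<lambda>z. ln (cmod (1 - x / z))) \<longlongrightarrow> 0) at_infinity" by simp
  moreover have "\<forall>\<^sub>F z in at_infinity. cmod z \<ge> cmod x + 1"
    unfolding eventually_at_infinity by blast
  then have "\<forall>\<^sub>F z in at_infinity. ln (cmod (1 - x / z)) = ln (cmod (z - x)) - ln (cmod z)"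
  proof eventually_elim
    case (elim z)
    then have nz: "z \<noteq> 0" "z \<noteq> x" using norm_ge_zero[of x] by (auto simp del: norm_ge_zero)
    then have "cmod (1 - x / z) = cmod (z - x) / cmod z"
      by (metis diff_divide_distrib divide_self norm_divide)
    then show ?case using nz by (simp add: ln_div)
  qed
  ultimately show ?thesis by (rule Lim_transform_eventually)
qed

text \<open>Near infinity a logarithmic potential depends only on its total weight. Two potentials
  of equal weight therefore have difference tending to \<open>0\<close>, which allows comparing them
  without knowing whether \<open>G z - ln \<bar>z\<bar>\<close> has a limit.\<close>

lemma weighted_ln_norm_at_infinity:
  fixes s :: "'i \<Rightarrow> real"
  assumes "finite I" "(\<Sum>i\<in>I. s i) = S"
  shows "((\<lambda>z. (\<Sum>i\<in>I. s i * ln (cmod (z - x i))) - S * ln (cmod z)) \<longlongrightarrow> 0) at_infinity"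
proof -
  have "((\<lambda>z. \<Sum>i\<in>I. s i * (ln (cmod (z - x i)) - ln (cmod z))) \<longlongrightarrow> (\<Sum>i\<in>I. s i * 0)) at_infinity"
    by (intro tendsto_intros ln_norm_diff_at_infinity)
  moreover have "(\<Sum>i\<in>I. s i * (ln (cmod (z - x i)) - ln (cmod z))) =
     (\<Sum>i\<in>I. s i * ln (cmod (z - x i))) - S * ln (cmod z)" for z
    by (simp add: right_diff_distrib sum_subtractf sum_distrib_right flip: assms(2))
  ultimately show ?thesis by simp
qed

lemma eventually_ne_roots: "\<forall>\<^sub>F z :: complex in at_infinity. \<forall>i\<in>{..<n::nat}. z \<noteq> a i"
proof (intro eventually_ball_finite ballI)
  fix i show "\<forall>\<^sub>F z in at_infinity. z \<noteq> a i"
    unfolding eventually_at_infinity by (intro exI[of _ "cmod (a i) + 1"]) auto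
qed simp

lemma norm_prod_eq_exp_sum_ln:
  assumes "finite I" "\<And>i. i \<in> I \<Longrightarrow> z \<noteq> a i"
  shows "cmod (\<Prod>i\<in>I. z - a i) = exp (\<Sum>i\<in>I. ln (cmod (z - a i)))"
  using assms by (subst exp_sum) (auto simp: prod_norm[symmetric] intro!: prod.cong)

text \<open>The consequences of regularity and connected complement that matter below: \<open>G\<close> is
  continuous on the whole plane, vanishes on \<open>e\<close> and is harmonic off \<open>e\<close>.\<close>

locale green_level_sets =
  fixes e :: "complex set" and G :: "complex \<Rightarrow> real"
  assumes compact_e: "compact e" and nonempty_e: "e \<noteq> {}"
    and continuous_G: "continuous_on UNIV G"
    and laplacian_G: "\<And>z. z \<notin> e \<Longrightarrow> has_laplacian G 0 z"
    and G_zero: "\<And>z. z \<in> e \<Longrightarrow> G z = 0"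
    and G_minus_ln: "\<exists>C. \<forall>\<^sub>F z in at_infinity. \<bar>G z - ln (cmod z)\<bar> \<le> C"
begin

abbreviation level :: "real \<Rightarrow> complex set" where
  "level \<alpha> \<equiv> {z. G z = \<alpha>}"

lemma ln_norm_at_top: "filterlim (\<lambda>z::complex. ln (cmod z)) at_top at_infinity"
  by (rule filterlim_compose[OF ln_at_top filterlim_norm_at_top])

lemma weighted_ln_minus_G_at_bot:
  assumes "finite I" "(\<Sum>i\<in>I. s i) < c"
  shows "filterlim (\<lambda>z. (\<Sum>i\<in>I. s i * ln (cmod (z - x i))) - c * G z) at_bot at_infinity"
proof -
  define S where "S = (\<Sum>i\<in>I. s i)"
  have Sc: "c - S > 0" using assms(2) by (simp add: S_def)
  obtain C where C: "\<forall>\<^sub>F z in at_infinity. \<bar>G z - ln (cmod z)\<bar> \<le> C" using G_minus_ln by blast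
  have 1: "\<forall>\<^sub>F z in at_infinity. (\<Sum>i\<in>I. s i * ln (cmod (z - x i))) - S * ln (cmod z) < 1"
    using weighted_ln_norm_at_infinity[OF assms(1) S_def[symmetric], of x]
    by (rule order_tendstoD) simp
  show ?thesis unfolding filterlim_at_bot
  proof
    fix Z :: real
    have "\<forall>\<^sub>F z::complex in at_infinity. ln (cmod z) \<ge> (1 + \<bar>c\<bar> * C - Z) / (c - S)"
      using ln_norm_at_top unfolding filterlim_at_top by blast
    then show "\<forall>\<^sub>F z in at_infinity. (\<Sum>i\<in>I. s i * ln (cmod (z - x i))) - c * G z \<le> Z"
      using 1 C
    proof eventually_elim
      case (elim z)
      have "1 + \<bar>c\<bar> * C - Z \<le> (c - S) * ln (cmod z)"
        using elim(1) Sc by (simp add: pos_divide_le_eq mult.commute)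
      moreover have "\<bar>c * (G z - ln (cmod z))\<bar> \<le> \<bar>c\<bar> * C"
        using elim(3) by (simp add: abs_mult mult_left_mono)
      then have "- (c * G z) + c * ln (cmod z) \<le> \<bar>c\<bar> * C" by (simp add: right_diff_distrib abs_le_iff)
      ultimately show ?case using elim(2) by (simp add: left_diff_distrib)
    qed
  qed
qed

lemma G_at_top: "filterlim G at_top at_infinity"
proof -
  have "filterlim (\<lambda>z. (\<Sum>i\<in>{}. (\<lambda>_. 0) i * ln (cmod (z - (\<lambda>_. 0) i))) - 1 * G z) at_bot at_infinity"
    by (rule weighted_ln_minus_G_at_bot) auto
  then have "filterlim (\<lambda>z. - G z) at_bot at_infinity" by simp
  then show ?thesis by (simp add: filterlim_uminus_at_bot)
qed

lemma closed_G_vimage: "closed T \<Longrightarrow> closed {z. G z \<in> T}"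
  using continuous_closed_vimage[of T G] continuous_G
  by (simp add: vimage_def continuous_on_eq_continuous_at)

lemma open_G_greater: "open {z. G z > \<alpha>}"
  using closed_G_vimage[of "{..\<alpha>}"] by (simp add: closed_def Collect_neg_eq[symmetric] not_le)

lemma compact_sublevel: "compact {z. G z \<le> \<alpha>}"
proof -
  have "\<forall>\<^sub>F z in at_infinity. G z \<ge> \<alpha> + 1" using G_at_top unfolding filterlim_at_top by blast
  then obtain R where R: "\<And>z. cmod z \<ge> R \<Longrightarrow> G z \<ge> \<alpha> + 1"
    unfolding eventually_at_infinity by blast
  have "bounded {z. G z \<le> \<alpha>}"
    unfolding bounded_iff
  proof (intro exI ballI)
    fix z assume "z \<in> {z. G z \<le> \<alpha>}"
    then show "cmod z \<le> R" using R[of z] by (intro leI notI) auto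
  qed
  then show ?thesis using closed_G_vimage[of "{..\<alpha>}"] by (simp add: compact_eq_bounded_closed)
qed

lemma compact_level: "compact (level \<alpha>)"
proof -
  have "level \<alpha> = {z. G z \<in> {\<alpha>}} \<inter> {z. G z \<le> \<alpha>}" by auto
  then show ?thesis using closed_G_vimage[of "{\<alpha>}"] compact_sublevel by (metis closed_Int_compact closed_singleton)
qed

text \<open>A finite set does not disconnect the plane, but \<open>G\<close> passes from \<open>0\<close> to large values.\<close>

lemma infinite_level:
  assumes "\<alpha> > 0"
  shows "infinite (level \<alpha>)"
proof
  assume "finite (level \<alpha>)"
  then have conn: "connected (- level \<alpha>)"
    by (intro path_connected_imp_connected path_connected_complement_countable countable_finite) auto
  obtain z0 where z0: "z0 \<in> e" using nonempty_e by blast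
  have "\<forall>\<^sub>F z in at_infinity. G z \<ge> \<alpha> + 1" using G_at_top unfolding filterlim_at_top by blast
  then obtain z1 where z1: "G z1 \<ge> \<alpha> + 1"
    using eventually_happens' trivial_limit_at_infinity by blast
  have "connected (G ` (- level \<alpha>))"
    by (intro connected_continuous_image conn continuous_on_subset[OF continuous_G]) auto
  moreover have "G z0 \<in> G ` (- level \<alpha>)" "G z1 \<in> G ` (- level \<alpha>)"
    using z0 z1 assms G_zero[OF z0] by auto
  moreover have "G z0 \<le> \<alpha>" "\<alpha> \<le> G z1" using z1 G_zero[OF z0] assms by auto
  ultimately have "\<alpha> \<in> G ` (- level \<alpha>)" by (meson connectedD_interval)
  then show False by auto
qed

text \<open>The Bernstein--Walsh inequality. For every exponent \<open>c > n\<close> the quotient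
  \<open>\<bar>P\<bar> exp (- c G)\<close> tends to \<open>0\<close> at infinity, so its maximum lies on \<open>B\<close>; then \<open>c\<close> decreases to
  \<open>n\<close>. The set \<open>S\<close> is \<open>{z. G z \<ge> \<alpha>}\<close> with boundary \<open>B = L\<^sub>\<alpha>\<close>, or the whole plane with \<open>B = e\<close>.\<close>

lemma bernstein_walsh:
  assumes S: "closed S" "open (S - B)" "B \<subseteq> S" "S - B \<subseteq> - e"
    and B: "\<And>w. w \<in> B \<Longrightarrow> G w = \<alpha>" "\<And>w. w \<in> B \<Longrightarrow> cmod (\<Prod>i<n. w - a i) \<le> M"
    and M: "M \<ge> 0" and z: "z \<in> S"
  shows "cmod (\<Prod>i<n. z - a i) \<le> M * exp (real n * (G z - \<alpha>))"
proof -
  have main: "cmod (\<Prod>i<n. z - a i) \<le> M * exp (c * (G z - \<alpha>))" if c: "c > real n" for c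
  proof -
    define F where "F z = cmod (\<Prod>i<n. z - a i) * exp (- c * G z)" for z
    have F_eq: "ln (F z) = (\<Sum>i<n. 1 * ln (cmod (z - a i))) - c * G z" "F z = exp (ln (F z))"
      if "\<And>i. i < n \<Longrightarrow> z \<noteq> a i" for z
      using norm_prod_eq_exp_sum_ln[of "{..<n}" z a] that unfolding F_def
      by (simp_all flip: exp_add)
    note ev = eventually_ne_roots[of n a]
    have "F z \<le> M * exp (- c * \<alpha>)"
    proof (rule maximum_principle[OF S(1-3), of F])
      show "continuous_on S F" unfolding F_def
        by (intro continuous_intros continuous_on_subset[OF continuous_G]) auto
      show "has_laplacian (\<lambda>z. ln (F z)) 0 w" if "w \<in> S - B" "F w > 0" for w
      proof -
        have ne: "w \<noteq> a i" if "i < n" for i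
        proof
          assume "w = a i"
          then have "(\<Prod>i<n. w - a i) = 0" using that by (intro prod_zero) auto
          then show False using \<open>F w > 0\<close> unfolding F_def
            by (metis less_irrefl mult_zero_left norm_zero)
        qed
        have we: "w \<notin> e" using that S(4) by auto
        have "has_laplacian (\<lambda>z. (\<Sum>i<n. ln (cmod (z - a i))) + (- c) * G z) (0 + (- c) * 0) w"
          using ne we by (intro has_laplacian_add has_laplacian_cmult has_laplacian_sum
              has_laplacian_ln_norm laplacian_G) auto
        moreover have "\<forall>\<^sub>F z in nhds w. z \<in> - (a ` {..<n})"
          using ne by (intro eventually_nhds_in_open) (auto intro: finite_imp_closed)
        then have "\<forall>\<^sub>F z in nhds w. (\<Sum>i<n. ln (cmod (z - a i))) + (- c) * G z = ln (F z)"
          by eventually_elim (subst F_eq(1), auto)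
        ultimately show ?thesis by (simp add: has_laplacian_cong)
      qed
      have "filterlim (\<lambda>z. (\<Sum>i<n. 1 * ln (cmod (z - a i))) - c * G z) at_bot at_infinity"
        by (rule weighted_ln_minus_G_at_bot) (use c in auto)
      then have "((\<lambda>z. exp ((\<Sum>i<n. 1 * ln (cmod (z - a i))) - c * G z)) \<longlongrightarrow> 0) at_infinity"
        by (rule filterlim_compose[OF exp_at_bot])
      moreover have "\<forall>\<^sub>F z in at_infinity. exp ((\<Sum>i<n. 1 * ln (cmod (z - a i))) - c * G z) = F z"
        using ev by eventually_elim (metis F_eq lessThan_iff)
      ultimately show "(F \<longlongrightarrow> 0) at_infinity" by (rule Lim_transform_eventually)
      show "F w \<le> M * exp (- c * \<alpha>)" if "w \<in> B" for w
        using B[OF that] by (simp add: F_def mult_right_mono)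
    qed (use z M in \<open>auto simp: F_def\<close>)
    then have "cmod (\<Prod>i<n. z - a i) * exp (- c * G z) * exp (c * G z) \<le> M * exp (- c * \<alpha>) * exp (c * G z)"
      unfolding F_def by (intro mult_right_mono) auto
    then show ?thesis by (simp add: mult.assoc flip: exp_add) (simp add: algebra_simps)
  qed
  have "((\<lambda>c. M * exp (c * (G z - \<alpha>))) \<longlongrightarrow> M * exp (real n * (G z - \<alpha>))) (at_right (real n))"
    by (intro tendsto_intros)
  moreover have "\<forall>\<^sub>F c in at_right (real n). cmod (\<Prod>i<n. z - a i) \<le> M * exp (c * (G z - \<alpha>))"
    using main by (auto simp: eventually_at_right_field intro: exI[of _ "real n + 1"])
  ultimately show ?thesis
    by (rule tendsto_lowerbound) simp
qed

text \<open>The counterpart from below, for potentials without singularities above the level \<open>\<alpha>\<close>: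
  \<open>exp (c G)\<close> divided by the exponential of the potential tends to \<open>0\<close> at infinity for \<open>c < 1\<close>.\<close>

lemma potential_lower_growth:
  fixes p :: "complex \<Rightarrow> real"
  assumes \<alpha>: "\<alpha> > 0" and X: "finite X" "\<And>x. x \<in> X \<Longrightarrow> G x < \<alpha>" and p: "(\<Sum>x\<in>X. p x) = 1"
    and m: "\<And>w. w \<in> level \<alpha> \<Longrightarrow> m \<le> (\<Sum>x\<in>X. p x * ln (cmod (w - x)))"
    and z: "G z \<ge> \<alpha>"
  shows "m + G z - \<alpha> \<le> (\<Sum>x\<in>X. p x * ln (cmod (z - x)))"
proof -
  have main: "m + c * (G z - \<alpha>) \<le> (\<Sum>x\<in>X. p x * ln (cmod (z - x)))" if c: "c < 1" for c
  proof -
    define F where "F z = exp ((\<Sum>x\<in>X. (- p x) * ln (cmod (z - x))) - (- c) * G z)" for z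
    have "F z \<le> exp (c * \<alpha> - m)"
    proof (rule maximum_principle[of "{z. G z \<ge> \<alpha>}" "level \<alpha>" F])
      show "closed {z. G z \<ge> \<alpha>}" using closed_G_vimage[of "{\<alpha>..}"] by simp
      have "{z. \<alpha> \<le> G z} - level \<alpha> = {z. G z > \<alpha>}" by auto
      then show "open ({z. \<alpha> \<le> G z} - level \<alpha>)" using open_G_greater by simp
      have "w \<noteq> x" if "\<alpha> \<le> G w" "x \<in> X" for w x using X(2)[OF that(2)] that(1) by auto
      then show "continuous_on {z. \<alpha> \<le> G z} F" unfolding F_def
        by (intro continuous_intros continuous_on_subset[OF continuous_G]) auto
      show "has_laplacian (\<lambda>z. ln (F z)) 0 w" if "w \<in> {z. \<alpha> \<le> G z} - level \<alpha>" for w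
      proof -
        have ne: "w \<noteq> x" if "x \<in> X" for x using X(2)[OF that] \<open>w \<in> _\<close> by auto
        have we: "w \<notin> e" using G_zero[of w] that \<alpha> by auto
        have "has_laplacian (\<lambda>z. (- p x) * ln (cmod (z - x))) 0 w" if "x \<in> X" for x
          using has_laplacian_cmult[OF has_laplacian_ln_norm[OF ne[OF that]], of "- p x"] by simp
        then have "has_laplacian (\<lambda>z. \<Sum>x\<in>X. (- p x) * ln (cmod (z - x))) 0 w"
          by (rule has_laplacian_sum[OF X(1)])
        from has_laplacian_add[OF this has_laplacian_cmult[OF laplacian_G[OF we], of c]]
        have "has_laplacian (\<lambda>z. (\<Sum>x\<in>X. (- p x) * ln (cmod (z - x))) + c * G z) 0 w" by simp
        then show ?thesis by (simp add: F_def)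
      qed
      have "filterlim (\<lambda>z. (\<Sum>x\<in>X. (- p x) * ln (cmod (z - x))) - (- c) * G z) at_bot at_infinity"
        using c X p by (intro weighted_ln_minus_G_at_bot) (auto simp: sum_negf)
      then show "(F \<longlongrightarrow> 0) at_infinity"
        unfolding F_def by (rule filterlim_compose[OF exp_at_bot])
      show "F w \<le> exp (c * \<alpha> - m)" if "w \<in> level \<alpha>" for w
        using m[OF that] that by (simp add: F_def sum_negf)
    qed (use z in \<open>auto simp: F_def\<close>)
    then show ?thesis by (simp add: F_def sum_negf algebra_simps)
  qed
  have "((\<lambda>c. m + c * (G z - \<alpha>)) \<longlongrightarrow> m + 1 * (G z - \<alpha>)) (at_left 1)"
    by (intro tendsto_intros)
  moreover have "\<forall>\<^sub>F c in at_left (1::real). m + c * (G z - \<alpha>) \<le> (\<Sum>x\<in>X. p x * ln (cmod (z - x)))"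
    using main by (auto simp: eventually_at_left_field intro: exI[of _ 0])
  ultimately have "m + 1 * (G z - \<alpha>) \<le> (\<Sum>x\<in>X. p x * ln (cmod (z - x)))"
    by (rule tendsto_upperbound) simp
  then show ?thesis by simp
qed

end

section \<open>The Robin constant and the extremal growth of polynomials\<close>

text \<open>The second-order estimate that controls one step of the multiplicative weights method.\<close>

lemma exp_le_quadratic:
  fixes y :: real
  assumes "\<bar>y\<bar> \<le> 1"
  shows "exp y \<le> 1 + y + y\<^sup>2"
proof (cases "y \<ge> 0")
  case True
  then show ?thesis using exp_bound[of y] assms by simp
next
  case False
  define x where "x = - y"
  have x: "x \<ge> 0" "y = - x" using False by (auto simp: x_def)
  have "1 \<le> 1 + x\<^sup>2 / 2 + x ^ 3 / 2 + x ^ 4 / 2" using x by simp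
  also have "\<dots> = (1 + y + y\<^sup>2) * (1 + x + x\<^sup>2 / 2)"
    by (simp add: x(2) field_simps power2_eq_square power3_eq_cube power4_eq_xxxx)
  also have "\<dots> \<le> (1 + y + y\<^sup>2) * exp x"
    using assms False x exp_lower_Taylor_quadratic[OF x(1)]
    by (intro mult_left_mono) (auto simp: abs_if)
  finally show ?thesis using x(2) by (simp add: exp_minus field_simps)
qed

context green_level_sets
begin

text \<open>Rates \<open>t\<close> at which some nonconstant monic polynomial stays below \<open>exp (n (t + \<alpha>))\<close> on some level
  curve. Monic polynomials are given by their roots throughout. The level may vary because the
  Bernstein--Walsh inequality keeps the rate when it passes to a higher level. The infimum \<open>\<tau>\<close> is
  the negative of the Robin constant of \<open>e\<close>.\<close>

definition growth_bounds :: "real set" where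
  "growth_bounds = {t. \<exists>n a \<alpha>. n \<ge> 1 \<and> \<alpha> > 0 \<and>
     (\<forall>z\<in>level \<alpha>. cmod (\<Prod>i<n. z - a i) \<le> exp (real n * (t + \<alpha>)))}"

definition \<tau> :: real where "\<tau> = Inf growth_bounds"

lemma bernstein_walsh_level:
  assumes "\<alpha> > 0" "\<And>w. w \<in> level \<alpha> \<Longrightarrow> cmod (\<Prod>i<n. w - a i) \<le> M" "M \<ge> 0" "G z \<ge> \<alpha>"
  shows "cmod (\<Prod>i<n. z - a i) \<le> M * exp (real n * (G z - \<alpha>))"
proof (rule bernstein_walsh[of "{z. G z \<ge> \<alpha>}" "level \<alpha>"])
  show "closed {z. G z \<ge> \<alpha>}" using closed_G_vimage[of "{\<alpha>..}"] by simp
  have "{z. \<alpha> \<le> G z} - level \<alpha> = {z. G z > \<alpha>}" by auto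
  then show "open ({z. \<alpha> \<le> G z} - level \<alpha>)" using open_G_greater by simp
  show "{z. \<alpha> \<le> G z} - level \<alpha> \<subseteq> - e" using G_zero assms(1) by force
qed (use assms in auto)

lemma bernstein_walsh_e:
  assumes "\<And>w. w \<in> e \<Longrightarrow> cmod (\<Prod>i<n. w - a i) \<le> M" "M \<ge> 0"
  shows "cmod (\<Prod>i<n. z - a i) \<le> M * exp (real n * G z)"
  using bernstein_walsh[where S = UNIV and B = e and \<alpha> = 0 and n = n and a = a and M = M and z = z] assms G_zero compact_imp_closed[OF compact_e]
  by (auto simp: Compl_eq_Diff_UNIV[symmetric])

text \<open>Above both levels the potential is at least \<open>m + G - \<alpha>\<close>, and the normalized logarithm of the
  polynomial that witnesses \<open>t\<close> is at most \<open>t + G\<close>. Both have total weight \<open>1\<close>, so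
  their difference tends to \<open>0\<close> at infinity and the two bounds can be compared there.\<close>

lemma potential_minimum_le:
  assumes t: "t \<in> growth_bounds"
    and \<alpha>: "\<alpha> > 0" and X: "finite X" "\<And>x. x \<in> X \<Longrightarrow> G x < \<alpha>" and p: "(\<Sum>x\<in>X. p x) = 1"
    and m: "\<And>w. w \<in> level \<alpha> \<Longrightarrow> m \<le> (\<Sum>x\<in>X. p x * ln (cmod (w - x)))"
  shows "m - \<alpha> \<le> t"
proof -
  obtain n a \<beta> where n: "n \<ge> 1" "\<beta> > 0"
    and M: "\<And>z. z \<in> level \<beta> \<Longrightarrow> cmod (\<Prod>i<n. z - a i) \<le> exp (real n * (t + \<beta>))"
    using t unfolding growth_bounds_def by blast
  note ev = eventually_ne_roots[of n a]
  have G_big: "\<forall>\<^sub>F z in at_infinity. G z \<ge> max \<alpha> \<beta>"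
    using G_at_top unfolding filterlim_at_top by blast
  have "\<forall>\<^sub>F z in at_infinity. m - \<alpha> - t \<le>
      (\<Sum>x\<in>X. p x * ln (cmod (z - x))) - (\<Sum>i<n. (1 / n) * ln (cmod (z - a i)))"
    using ev G_big
  proof eventually_elim
    case (elim z)
    have "exp (\<Sum>i<n. ln (cmod (z - a i))) \<le> exp (real n * (t + \<beta>)) * exp (real n * (G z - \<beta>))"
      using bernstein_walsh_level[OF n(2) M, of z] elim norm_prod_eq_exp_sum_ln[of "{..<n}" z a] by simp
    then have "(\<Sum>i<n. ln (cmod (z - a i))) \<le> real n * (t + G z)"
      by (simp flip: exp_add) (simp add: algebra_simps)
    then have "(\<Sum>i<n. (1 / n) * ln (cmod (z - a i))) \<le> t + G z"
      using n by (simp add: field_simps flip: sum_divide_distrib)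
    moreover have "m + G z - \<alpha> \<le> (\<Sum>x\<in>X. p x * ln (cmod (z - x)))"
      using potential_lower_growth[OF \<alpha> X p m] elim by simp
    ultimately show ?case by simp
  qed
  moreover have "((\<lambda>z. (\<Sum>x\<in>X. p x * ln (cmod (z - x))) - 1 * ln (cmod z) -
      ((\<Sum>i<n. (1 / n) * ln (cmod (z - a i))) - 1 * ln (cmod z))) \<longlongrightarrow> 0 - 0) at_infinity"
    using n by (intro tendsto_diff weighted_ln_norm_at_infinity X p) auto
  then have "((\<lambda>z. (\<Sum>x\<in>X. p x * ln (cmod (z - x))) -
      (\<Sum>i<n. (1 / n) * ln (cmod (z - a i)))) \<longlongrightarrow> 0) at_infinity" by simp
  ultimately have "m - \<alpha> - t \<le> 0"
    by (intro tendsto_lowerbound) (auto simp: trivial_limit_at_infinity)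
  then show ?thesis by simp
qed

lemma growth_bounds_nonempty: "growth_bounds \<noteq> {}"
proof -
  have "bounded (level 1)" using compact_level compact_imp_bounded by blast
  then obtain B where B: "B > 0" "\<forall>z\<in>level 1. cmod z \<le> B"
    unfolding bounded_pos by blast
  then have "\<forall>z\<in>level 1. cmod (\<Prod>i<(1::nat). z - 0) \<le> exp (real 1 * ((ln B - 1) + 1))"
    by simp
  then have "ln B - 1 \<in> growth_bounds" unfolding growth_bounds_def
    by (intro CollectI exI[of _ 1] exI[of _ "\<lambda>_. 0"] conjI) auto
  then show ?thesis by blast
qed

lemma potential_attains_minimum_on_level:
  assumes "\<alpha> > 0" "\<And>x. x \<in> X \<Longrightarrow> G x < \<alpha>"
  obtains w where "w \<in> level \<alpha>"
    "\<And>v. v \<in> level \<alpha> \<Longrightarrow> (\<Sum>x\<in>X. p x * ln (cmod (w - x))) \<le> (\<Sum>x\<in>X. p x * ln (cmod (v - x)))"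
proof -
  have "level \<alpha> \<noteq> {}" using infinite_level[OF assms(1)] by (metis infinite_imp_nonempty)
  moreover have "w \<noteq> x" if "w \<in> level \<alpha>" "x \<in> X" for w x
    using assms(2)[OF that(2)] that(1) by auto
  then have "continuous_on (level \<alpha>) (\<lambda>w. \<Sum>x\<in>X. p x * ln (cmod (w - x)))"
    by (intro continuous_intros) auto
  ultimately obtain w where "w \<in> level \<alpha>"
    "\<forall>v\<in>level \<alpha>. (\<Sum>x\<in>X. p x * ln (cmod (w - x))) \<le> (\<Sum>x\<in>X. p x * ln (cmod (v - x)))"
    using continuous_attains_inf[OF compact_level] by blast
  then show ?thesis using that by blast
qed

text \<open>A point mass on \<open>e\<close> already provides a lower bound.\<close>

lemma bdd_below_growth_bounds: "bdd_below growth_bounds"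
proof -
  obtain x where x: "x \<in> e" using nonempty_e by blast
  obtain w where w: "w \<in> level 1"
    "\<And>v. v \<in> level 1 \<Longrightarrow> (\<Sum>x\<in>{x}. 1 * ln (cmod (w - x))) \<le> (\<Sum>x\<in>{x}. 1 * ln (cmod (v - x)))"
    by (rule potential_attains_minimum_on_level[of 1 "{x}" "\<lambda>_. 1"]) (use G_zero[OF x] in auto)
  have "ln (cmod (w - x)) - 1 \<le> t" if "t \<in> growth_bounds" for t
    using potential_minimum_le[OF that, of 1 "{x}" "\<lambda>_. 1" "ln (cmod (w - x))"] w G_zero[OF x]
    by auto
  then show ?thesis by (rule bdd_belowI)
qed

lemma ex_point_small_potential:
  assumes "\<alpha> > 0" "finite X" "\<And>x. x \<in> X \<Longrightarrow> G x < \<alpha>" "(\<Sum>x\<in>X. p x) = 1"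
  obtains w where "w \<in> level \<alpha>" "(\<Sum>x\<in>X. p x * ln (cmod (w - x))) \<le> \<tau> + \<alpha>"
proof -
  obtain w where w: "w \<in> level \<alpha>"
    "\<And>v. v \<in> level \<alpha> \<Longrightarrow> (\<Sum>x\<in>X. p x * ln (cmod (w - x))) \<le> (\<Sum>x\<in>X. p x * ln (cmod (v - x)))"
    using potential_attains_minimum_on_level[OF assms(1,3)] by blast
  have "(\<Sum>x\<in>X. p x * ln (cmod (w - x))) - \<alpha> \<le> \<tau>"
    unfolding \<tau>_def using growth_bounds_nonempty
    by (rule cInf_greatest) (rule potential_minimum_le[OF _ assms w(2)])
  then show ?thesis using that w(1) by simp
qed

lemma prod_roots_large_on_level:
  assumes "\<alpha> > 0"
  obtains z where "z \<in> level \<alpha>" "cmod (\<Prod>i<n. z - a i) \<ge> exp (real n * (\<tau> + \<alpha>))"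
    "\<And>w. w \<in> level \<alpha> \<Longrightarrow> cmod (\<Prod>i<n. w - a i) \<le> cmod (\<Prod>i<n. z - a i)"
proof -
  have "level \<alpha> \<noteq> {}" using infinite_level[OF assms(1)] by (metis infinite_imp_nonempty)
  moreover have "continuous_on (level \<alpha>) (\<lambda>w. cmod (\<Prod>i<n. w - a i))"
    by (intro continuous_intros)
  ultimately obtain z where z: "z \<in> level \<alpha>"
    "\<And>w. w \<in> level \<alpha> \<Longrightarrow> cmod (\<Prod>i<n. w - a i) \<le> cmod (\<Prod>i<n. z - a i)"
    using continuous_attains_sup[OF compact_level] by blast
  define M where "M = cmod (\<Prod>i<n. z - a i)"
  have "M \<ge> exp (real n * (\<tau> + \<alpha>))"
  proof (rule ccontr)
    assume "\<not> ?thesis"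
    then have less: "M < exp (real n * (\<tau> + \<alpha>))" by simp
    have n: "n \<ge> 1" using less by (cases n) (auto simp: M_def)
    have "\<exists>t<\<tau>. M \<le> exp (real n * (t + \<alpha>))"
    proof (cases "M > 0")
      case True
      then have "ln M < real n * (\<tau> + \<alpha>)" using less by (metis exp_less_cancel_iff exp_ln)
      then have "ln M / n - \<alpha> < \<tau>" using n by (simp add: field_simps)
      moreover have "real n * (ln M / n - \<alpha> + \<alpha>) = ln M" using n by simp
      ultimately show ?thesis using True by (metis exp_ln order_refl)
    next
      case False
      then have "M \<le> exp (real n * (\<tau> - 1 + \<alpha>))" by (meson exp_gt_zero less_le_trans not_le order.strict_iff_order)
      then show ?thesis by (intro exI[of _ "\<tau> - 1"]) auto
    qed
    then obtain t where t: "t < \<tau>" "M \<le> exp (real n * (t + \<alpha>))" by blast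
    have "\<forall>w\<in>level \<alpha>. cmod (\<Prod>i<n. w - a i) \<le> exp (real n * (t + \<alpha>))"
      using z(2) t(2) unfolding M_def by fastforce
    then have "t \<in> growth_bounds" unfolding growth_bounds_def using n assms by blast
    then have "\<tau> \<le> t" unfolding \<tau>_def using bdd_below_growth_bounds by (rule cInf_lower)
    then show False using t by simp
  qed
  then show ?thesis using that z unfolding M_def by blast
qed

text \<open>The finite minimax theorem behind the construction, by the multiplicative weights method.
  The current weight of \<open>x\<close> is \<open>exp\<close> of \<open>\<eta>\<close> times the sum of \<open>ln \<bar>w - x\<bar>\<close> over the points \<open>w\<close>
  chosen so far, and the next point is one where the potential of the normalized weights is at most
  \<open>\<tau> + \<alpha>\<close>. Hence each step multiplies the total weight at most by
  \<open>exp (\<eta> (\<tau> + \<alpha>) + \<eta>\<^sup>2 C\<^sup>2)\<close>, and it bounds every single weight.\<close>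

lemma ex_multiplicative_weights_points:
  assumes \<alpha>: "\<alpha> > 0" and X: "finite X" "\<And>x. x \<in> X \<Longrightarrow> G x < \<alpha>" "X \<noteq> {}"
    and C: "C > 0" "\<And>x w. x \<in> X \<Longrightarrow> w \<in> level \<alpha> \<Longrightarrow> \<bar>ln (cmod (w - x))\<bar> \<le> C"
    and \<eta>: "\<eta> > 0" "\<eta> * C \<le> 1"
  obtains w :: "nat \<Rightarrow> complex" where "\<And>i. w i \<in> level \<alpha>"
    "\<And>T x. x \<in> X \<Longrightarrow> \<eta> * (\<Sum>i<T. ln (cmod (w i - x))) \<le>
        ln (card X) + real T * (\<eta> * (\<tau> + \<alpha>) + \<eta>\<^sup>2 * C\<^sup>2)"
proof -
  define W where "W ws x = exp (\<eta> * (\<Sum>v\<leftarrow>ws. ln (cmod (v - x))))" for ws :: "complex list" and x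
  define \<Phi> where "\<Phi> ws = (\<Sum>x\<in>X. W ws x)" for ws
  have \<Phi>pos: "\<Phi> ws > 0" for ws unfolding \<Phi>_def W_def using X by (intro sum_pos) auto
  have "\<exists>v. v \<in> level \<alpha> \<and> (\<Sum>x\<in>X. (W ws x / \<Phi> ws) * ln (cmod (v - x))) \<le> \<tau> + \<alpha>" for ws
  proof -
    have "(\<Sum>x\<in>X. W ws x / \<Phi> ws) = 1"
      using \<Phi>pos[of ws] by (simp add: \<Phi>_def flip: sum_divide_distrib)
    from ex_point_small_potential[OF \<alpha> X(1,2) this] show ?thesis by blast
  qed
  then obtain f where f: "\<And>ws. f ws \<in> level \<alpha>"
    "\<And>ws. (\<Sum>x\<in>X. (W ws x / \<Phi> ws) * ln (cmod (f ws - x))) \<le> \<tau> + \<alpha>" by metis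
  \<comment> \<open>The history lists the chosen points, the latest one first.\<close>
  define hist where "hist = rec_nat [] (\<lambda>_ ws. f ws # ws)"
  have hist: "hist 0 = []" "\<And>n. hist (Suc n) = f (hist n) # hist n" by (simp_all add: hist_def)
  define w where "w n = f (hist n)" for n
  define q where "q = \<eta> * (\<tau> + \<alpha>) + \<eta>\<^sup>2 * C\<^sup>2"
  have step: "\<Phi> (hist (Suc n)) \<le> \<Phi> (hist n) * exp q" for n
  proof -
    let ?l = "\<lambda>x. ln (cmod (w n - x))"
    have l: "\<bar>?l x\<bar> \<le> C" if "x \<in> X" for x using C(2)[OF that f(1)] by (simp add: w_def)
    have "\<Phi> (hist (Suc n)) = (\<Sum>x\<in>X. W (hist n) x * exp (\<eta> * ?l x))"
      unfolding \<Phi>_def W_def hist w_def by (simp add: ring_distribs exp_add mult.commute)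
    also have "\<dots> \<le> (\<Sum>x\<in>X. W (hist n) x * (1 + \<eta> * ?l x + \<eta>\<^sup>2 * C\<^sup>2))"
    proof (intro sum_mono mult_left_mono)
      fix x assume x: "x \<in> X"
      have "\<bar>\<eta> * ?l x\<bar> \<le> \<eta> * C" using l[OF x] \<eta>(1) by (simp add: abs_mult)
      then have "exp (\<eta> * ?l x) \<le> 1 + \<eta> * ?l x + (\<eta> * ?l x)\<^sup>2" using \<eta>(2) by (intro exp_le_quadratic) simp
      moreover have "(\<eta> * ?l x)\<^sup>2 \<le> (\<eta> * C)\<^sup>2"
        using \<open>\<bar>\<eta> * ?l x\<bar> \<le> \<eta> * C\<close> by (metis abs_le_square_iff abs_of_nonneg order_trans abs_ge_zero)
      ultimately show "exp (\<eta> * ?l x) \<le> 1 + \<eta> * ?l x + \<eta>\<^sup>2 * C\<^sup>2" by (simp add: power_mult_distrib)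
    qed (simp add: W_def)
    also have "\<dots> = \<Phi> (hist n) * (1 + \<eta>\<^sup>2 * C\<^sup>2) + \<eta> * (\<Sum>x\<in>X. W (hist n) x * ?l x)"
      by (simp add: \<Phi>_def algebra_simps sum.distrib sum_distrib_left sum_distrib_right)
    also have "(\<Sum>x\<in>X. W (hist n) x * ?l x) \<le> \<Phi> (hist n) * (\<tau> + \<alpha>)"
    proof -
      have "(\<Sum>x\<in>X. W (hist n) x * ?l x) / \<Phi> (hist n) \<le> \<tau> + \<alpha>"
        using f(2)[of "hist n"] by (simp add: w_def sum_divide_distrib)
      then show ?thesis using \<Phi>pos[of "hist n"] by (simp add: pos_divide_le_eq mult.commute)
    qed
    finally have "\<Phi> (hist (Suc n)) \<le> \<Phi> (hist n) * (1 + \<eta>\<^sup>2 * C\<^sup>2) + \<eta> * (\<Phi> (hist n) * (\<tau> + \<alpha>))"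
      using \<eta>(1) by (simp add: mult_left_mono)
    also have "\<dots> = \<Phi> (hist n) * (1 + q)" by (simp add: q_def algebra_simps)
    also have "\<dots> \<le> \<Phi> (hist n) * exp q" using \<Phi>pos[of "hist n"] by (intro mult_left_mono) auto
    finally show ?thesis .
  qed
  have pot: "\<Phi> (hist n) \<le> card X * exp (n * q)" for n
  proof (induction n)
    case (Suc n)
    have "\<Phi> (hist (Suc n)) \<le> (card X * exp (n * q)) * exp q"
      using step[of n] Suc by (meson exp_ge_zero mult_right_mono order_trans)
    also have "\<dots> = card X * exp (Suc n * q)" by (simp add: algebra_simps exp_add)
    finally show ?case .
  qed (simp add: hist \<Phi>_def W_def)
  have sum_hist: "(\<Sum>v\<leftarrow>hist n. ln (cmod (v - x))) = (\<Sum>i<n. ln (cmod (w i - x)))" for n x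
    by (induction n) (auto simp: hist w_def)
  show ?thesis
  proof
    show "w i \<in> level \<alpha>" for i by (simp add: w_def f(1)[simplified])
    fix T x assume x: "x \<in> X"
    have "exp (\<eta> * (\<Sum>i<T. ln (cmod (w i - x)))) \<le> \<Phi> (hist T)"
      unfolding \<Phi>_def sum_hist[symmetric] W_def[symmetric] using x X(1)
      by (intro member_le_sum) (auto simp: W_def)
    also note pot
    finally have "\<eta> * (\<Sum>i<T. ln (cmod (w i - x))) \<le> ln (card X * exp (T * q))"
      by (metis exp_gt_zero less_le_trans ln_exp ln_le_cancel_iff)
    also have "\<dots> = ln (card X) + T * q" using X by (subst ln_mult) (auto simp: card_gt_0_iff)
    finally show "\<eta> * (\<Sum>i<T. ln (cmod (w i - x))) \<le>
        ln (card X) + real T * (\<eta> * (\<tau> + \<alpha>) + \<eta>\<^sup>2 * C\<^sup>2)" by (simp add: q_def)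
  qed
qed

text \<open>A sufficiently fine finite net \<open>X\<close> of the sublevel set suffices: the sublevel set and \<open>L\<^sub>\<beta>\<close> have
  positive distance \<open>d\<close>, so moving \<open>z\<close> by \<open>\<epsilon> d / 3\<close> changes each \<open>ln \<bar>z - w\<bar>\<close> by at most
  \<open>\<epsilon> / 3\<close>. The step size \<open>\<eta>\<close> and the number \<open>T\<close> of steps make the two error terms of the
  multiplicative weights bound at most \<open>\<epsilon> / 3\<close> per step as well.\<close>

lemma small_poly_on_sublevel:
  assumes \<alpha>: "\<alpha> \<ge> 0" "\<alpha> < \<beta>" and \<epsilon>: "\<epsilon> > 0"
  obtains N w where "N \<ge> 1"
    "\<And>z. G z \<le> \<alpha> \<Longrightarrow> cmod (\<Prod>i<N. z - w i) \<le> exp (real N * (\<tau> + \<beta> + \<epsilon>))"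
proof -
  let ?K = "{z. G z \<le> \<alpha>}"
  have \<beta>: "\<beta> > 0" using \<alpha> by simp
  obtain z0 where "z0 \<in> e" using nonempty_e by blast
  then have "z0 \<in> ?K" using G_zero[of z0] \<alpha>(1) by simp
  then have K: "compact ?K" "?K \<noteq> {}" using compact_sublevel by blast+
  have "?K \<inter> level \<beta> = {}" using \<alpha> by auto
  then obtain d where d: "d > 0" "\<And>z w. z \<in> ?K \<Longrightarrow> w \<in> level \<beta> \<Longrightarrow> d \<le> dist z w"
    using separate_compact_closed[OF K(1) compact_imp_closed[OF compact_level[of \<beta>]]] by blast
  have "bounded (?K \<union> level \<beta>)" using K compact_level compact_imp_bounded by blast
  then obtain R where R: "R > 0" "\<And>z. z \<in> ?K \<union> level \<beta> \<Longrightarrow> cmod z \<le> R"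
    unfolding bounded_pos by blast
  define C where "C = \<bar>ln d\<bar> + \<bar>ln (2 * R)\<bar> + 1"
  have C: "C > 0" by (simp add: C_def)
  have bd: "\<bar>ln (cmod (w - z))\<bar> \<le> C" if "z \<in> ?K" "w \<in> level \<beta>" for z w
  proof -
    have "d \<le> cmod (w - z)" using d(2)[OF that] by (simp add: dist_norm norm_minus_commute)
    moreover have "cmod (w - z) \<le> 2 * R"
      using norm_triangle_ineq4[of w z] R(2)[of z] R(2)[of w] that by auto
    moreover from calculation(1) have "w \<noteq> z" using d(1) by auto
    ultimately have "ln d \<le> ln (cmod (w - z))" "ln (cmod (w - z)) \<le> ln (2 * R)"
      using d(1) R(1) by (simp_all add: ln_le_cancel_iff)
    then show ?thesis by (simp add: C_def)
  qed
  have r: "\<epsilon> / 3 * d > 0" using d(1) \<epsilon> by simp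
  from seq_compact_imp_totally_bounded[OF compact_imp_seq_compact[OF K(1)], THEN spec, THEN mp, OF r]
  obtain X where X: "finite X" "X \<subseteq> ?K" "?K \<subseteq> (\<Union>x\<in>X. ball x (\<epsilon> / 3 * d))"
    by (elim exE conjE)
  have Xne: "X \<noteq> {}" using X(3) K(2) by auto
  define \<eta> where "\<eta> = min (1 / C) (\<epsilon> / (3 * C\<^sup>2))"
  have \<eta>: "\<eta> > 0" "\<eta> * C \<le> 1" "\<eta> * C\<^sup>2 \<le> \<epsilon> / 3"
  proof -
    show "\<eta> > 0" using C \<epsilon> by (simp add: \<eta>_def)
    have "\<eta> \<le> 1 / C" "\<eta> \<le> \<epsilon> / (3 * C\<^sup>2)" by (simp_all add: \<eta>_def)
    then show "\<eta> * C \<le> 1" "\<eta> * C\<^sup>2 \<le> \<epsilon> / 3" using C by (simp_all add: field_simps)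
  qed
  obtain w where w: "\<And>i. w i \<in> level \<beta>"
    "\<And>T x. x \<in> X \<Longrightarrow> \<eta> * (\<Sum>i<T. ln (cmod (w i - x))) \<le>
        ln (card X) + real T * (\<eta> * (\<tau> + \<beta>) + \<eta>\<^sup>2 * C\<^sup>2)"
  proof (rule ex_multiplicative_weights_points[OF \<beta> X(1) _ Xne C _ \<eta>(1,2)])
    show "G x < \<beta>" if "x \<in> X" for x using X(2) that \<alpha>(2) by force
    show "\<bar>ln (cmod (w - x))\<bar> \<le> C" if "x \<in> X" "w \<in> level \<beta>" for x w using bd that X(2) by blast
  qed (rule that)
  define T where "T = Suc (nat \<lceil>3 * ln (card X) / (\<eta> * \<epsilon>)\<rceil>)"
  have "3 * ln (card X) / (\<eta> * \<epsilon>) \<le> T" unfolding T_def by linarith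
  then have T: "ln (card X) \<le> \<eta> * (T * (\<epsilon> / 3))"
    using \<eta>(1) \<epsilon> by (simp add: field_simps)
  show ?thesis
  proof
    show "T \<ge> 1" by (simp add: T_def)
    fix z assume z: "G z \<le> \<alpha>"
    then obtain x where x: "x \<in> X" "dist x z < \<epsilon> / 3 * d" using X(3) by auto
    have ne: "z \<noteq> w i" for i using z w(1)[of i] \<alpha> by auto
    have "\<eta> * (\<Sum>i<T. ln (cmod (w i - x))) \<le> \<eta> * (T * (\<epsilon> / 3)) + T * (\<eta> * (\<tau> + \<beta>) + \<eta>\<^sup>2 * C\<^sup>2)"
      using w(2)[OF x(1), of T] T by linarith
    also have "\<dots> = \<eta> * (T * (\<epsilon> / 3 + \<tau> + \<beta> + \<eta> * C\<^sup>2))" by (simp add: algebra_simps power2_eq_square)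
    finally have "(\<Sum>i<T. ln (cmod (w i - x))) \<le> T * (\<epsilon> / 3 + \<tau> + \<beta> + \<eta> * C\<^sup>2)"
      using \<eta>(1) by simp
    also have "\<dots> \<le> T * (\<epsilon> / 3 + \<tau> + \<beta> + \<epsilon> / 3)" using \<eta>(3) by (intro mult_left_mono) auto
    finally have 1: "(\<Sum>i<T. ln (cmod (w i - x))) \<le> T * (\<epsilon> / 3 + \<tau> + \<beta> + \<epsilon> / 3)" .
    have "ln (cmod (z - w i)) \<le> ln (cmod (w i - x)) + \<epsilon> / 3" for i
    proof -
      define b where "b = cmod (w i - x)"
      have b: "b \<ge> d" using d(2)[of x "w i"] x(1) X(2) w(1)[of i]
        by (auto simp: b_def dist_norm norm_minus_commute)
      have "cmod (z - w i) \<le> b + dist x z" unfolding b_def dist_norm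
        using norm_triangle_ineq[of "z - x" "x - w i"] by (simp add: norm_minus_commute)
      also have "\<dots> \<le> b + \<epsilon> / 3 * b" using x(2) b \<epsilon> by (smt (verit) divide_pos_pos mult_left_mono)
      finally have "cmod (z - w i) \<le> b * (1 + \<epsilon> / 3)" by (simp add: algebra_simps)
      then have "ln (cmod (z - w i)) \<le> ln (b * (1 + \<epsilon> / 3))" using ne[of i] b d(1) \<epsilon> by (subst ln_le_cancel_iff) auto
      also have "\<dots> = ln b + ln (1 + \<epsilon> / 3)" using b d(1) \<epsilon> by (intro ln_mult_pos) auto
      also have "\<dots> \<le> ln b + \<epsilon> / 3" using \<epsilon> ln_add_one_self_le_self[of "\<epsilon> / 3"] by simp
      finally show ?thesis by (simp add: b_def)
    qed
    then have "(\<Sum>i<T. ln (cmod (z - w i))) \<le> (\<Sum>i<T. ln (cmod (w i - x)) + \<epsilon> / 3)"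
      by (intro sum_mono) auto
    also have "\<dots> \<le> T * (\<tau> + \<beta> + \<epsilon>)" using 1 by (simp add: sum.distrib algebra_simps)
    finally show "cmod (\<Prod>i<T. z - w i) \<le> exp (real T * (\<tau> + \<beta> + \<epsilon>))"
      using norm_prod_eq_exp_sum_ln[of "{..<T}" z w] ne by simp
  qed
qed

end

section \<open>Products of mutual distances\<close>

text \<open>Compare leading coefficients in the Lagrange interpolation formula, which reproduces \<open>q\<close>
  because its degree is smaller than the number of nodes.\<close>

lemma sum_lagrange_leading_coefficient:
  fixes q :: "'a :: field poly"
  assumes X: "finite X" and deg: "degree q + 1 = card X"
  shows "(\<Sum>x\<in>X. poly q x / (\<Prod>y\<in>X - {x}. x - y)) = lead_coeff q"
proof -
  define l where "l x = (\<Prod>y\<in>X - {x}. [:- y, 1:])" for x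
  define L where "L = (\<Sum>x\<in>X. smult (poly q x / (\<Prod>y\<in>X - {x}. x - y)) (l x))"
  have deg_l: "degree (l x) = degree q" "lead_coeff (l x) = 1" if "x \<in> X" for x
    using X that deg unfolding l_def
    by (subst degree_prod_eq_sum_degree) (auto simp: lead_coeff_prod)
  have "q = L"
  proof (rule poly_eqI_degree[of X])
    fix x assume x: "x \<in> X"
    have "poly (l x') x = 0" if "x' \<in> X" "x' \<noteq> x" for x'
      unfolding l_def poly_prod using X x that by (intro prod_zero) auto
    then have "poly L x = poly q x / (\<Prod>y\<in>X - {x}. x - y) * poly (l x) x"
      unfolding L_def poly_sum using X x by (subst sum.remove[of _ x]) auto
    also have "poly (l x) x = (\<Prod>y\<in>X - {x}. x - y)" by (simp add: l_def poly_prod)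
    also have "poly q x / (\<Prod>y\<in>X - {x}. x - y) * (\<Prod>y\<in>X - {x}. x - y) = poly q x"
      using X by simp
    finally show "poly q x = poly L x" by simp
  next
    show "degree q < card X" using deg by simp
    have "degree L \<le> degree q" unfolding L_def
      using deg_l(1) by (intro degree_sum_le X) (metis degree_smult_le)
    then show "degree L < card X" using deg by simp
  qed
  then have "lead_coeff q = coeff L (degree q)" by simp
  also have "\<dots> = (\<Sum>x\<in>X. poly q x / (\<Prod>y\<in>X - {x}. x - y))"
    unfolding L_def coeff_sum using deg_l by (intro sum.cong refl) (metis coeff_smult mult.right_neutral)
  finally show ?thesis by simp
qed

text \<open>If all these products exceeded \<open>card X * M\<close>, the interpolation formula would represent the
  leading coefficient \<open>1\<close> as a sum of modulus below \<open>1\<close>.\<close>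

lemma ex_small_distance_product:
  fixes q :: "complex poly" and M :: real
  assumes X: "finite X" and deg: "degree q + 1 = card X" "lead_coeff q = 1"
    and M: "\<And>x. x \<in> X \<Longrightarrow> cmod (poly q x) \<le> M"
  obtains x where "x \<in> X" "(\<Prod>y\<in>X - {x}. cmod (x - y)) \<le> card X * M"
proof -
  have "X \<noteq> {}" using deg by auto
  define W where "W x = (\<Prod>y\<in>X - {x}. cmod (x - y))" for x
  have W: "W x > 0" for x unfolding W_def by (intro prod_pos) auto
  have "\<exists>x\<in>X. W x \<le> card X * M"
  proof (rule ccontr)
    assume "\<not> ?thesis"
    then have *: "\<And>x. x \<in> X \<Longrightarrow> card X * M < W x" by force
    have "1 = cmod (\<Sum>x\<in>X. poly q x / (\<Prod>y\<in>X - {x}. x - y))"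
      using sum_lagrange_leading_coefficient[OF X deg(1)] deg(2) by simp
    also have "\<dots> \<le> (\<Sum>x\<in>X. cmod (poly q x) / W x)"
      by (rule order_trans[OF norm_sum]) (simp add: norm_divide W_def prod_norm)
    also have "\<dots> < (\<Sum>x\<in>X. 1 / card X)"
    proof (rule sum_strict_mono[OF X \<open>X \<noteq> {}\<close>])
      fix x assume x: "x \<in> X"
      have "cmod (poly q x) * card X \<le> M * card X" using M[OF x] by (intro mult_right_mono) auto
      also have "\<dots> < W x" using *[OF x] by (simp add: mult.commute)
      finally have less: "cmod (poly q x) * card X < W x" .
      have "card X > 0" using X x by (auto simp: card_gt_0_iff)
      then show "cmod (poly q x) / W x < 1 / card X"
        using W[of x] less by (simp add: divide_less_eq less_divide_eq)
    qed
    also have "\<dots> = 1" using X \<open>X \<noteq> {}\<close> by simp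
    finally show False by simp
  qed
  then show ?thesis using that unfolding W_def by blast
qed

definition distance_product :: "complex set \<Rightarrow> real" where
  "distance_product X = (\<Prod>x\<in>X. \<Prod>y\<in>X - {x}. cmod (x - y))"

lemma distance_product_remove:
  assumes "finite X" "x \<in> X"
  shows "distance_product X = distance_product (X - {x}) * (\<Prod>y\<in>X - {x}. cmod (x - y))\<^sup>2"
proof -
  have "distance_product X = (\<Prod>y\<in>X - {x}. cmod (x - y)) * (\<Prod>z\<in>X - {x}. \<Prod>y\<in>X - {z}. cmod (z - y))"
    unfolding distance_product_def using assms by (subst prod.remove[of _ x]) auto
  also have "(\<Prod>z\<in>X - {x}. \<Prod>y\<in>X - {z}. cmod (z - y)) =
      (\<Prod>z\<in>X - {x}. cmod (x - z) * (\<Prod>y\<in>X - {x} - {z}. cmod (z - y)))"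
  proof (rule prod.cong)
    fix z assume z: "z \<in> X - {x}"
    then have "X - {z} = insert x (X - {x} - {z})" using assms by auto
    then show "(\<Prod>y\<in>X - {z}. cmod (z - y)) = cmod (x - z) * (\<Prod>y\<in>X - {x} - {z}. cmod (z - y))"
      using assms(1) z by (simp add: norm_minus_commute)
  qed simp
  finally show ?thesis by (simp add: distance_product_def prod.distrib power2_eq_square)
qed

text \<open>Remove one point at a time, each time a point whose product of distances to the others is
  small. A factor \<open>A\<close> appears for every ordered pair of points; the remaining factors
  \<open>(n! B\<^sup>n)\<^sup>2\<close> have a logarithm of order \<open>n ln n\<close>, negligible against \<open>n\<^sup>2\<close>.\<close>

lemma distance_product_le:
  assumes q: "\<And>k. \<exists>q :: complex poly. degree q = k \<and> lead_coeff q = 1 \<and>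
      (\<forall>z\<in>K. cmod (poly q z) \<le> B * A ^ k)"
    and pos: "A \<ge> 0" "B \<ge> 0"
    and X: "finite X" "X \<subseteq> K" "card X = n"
  shows "distance_product X \<le> (fact n * B ^ n)\<^sup>2 * A ^ (n * (n - 1))"
  using X
proof (induction n arbitrary: X)
  case 0
  then show ?case by (simp add: distance_product_def)
next
  case (Suc m)
  obtain q :: "complex poly" where q: "degree q = m" "lead_coeff q = 1" "\<forall>z\<in>K. cmod (poly q z) \<le> B * A ^ m"
    using q by blast
  obtain x where x: "x \<in> X" "(\<Prod>y\<in>X - {x}. cmod (x - y)) \<le> card X * (B * A ^ m)"
  proof (rule ex_small_distance_product[OF Suc.prems(1), of q "B * A ^ m"])
    show "cmod (poly q x) \<le> B * A ^ m" if "x \<in> X" for x using q(3) Suc.prems(2) that by blast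
  qed (use q Suc.prems in simp_all)
  have "distance_product X = distance_product (X - {x}) * (\<Prod>y\<in>X - {x}. cmod (x - y))\<^sup>2"
    using Suc.prems(1) x(1) by (rule distance_product_remove)
  also have "\<dots> \<le> ((fact m * B ^ m)\<^sup>2 * A ^ (m * (m - 1))) * (Suc m * (B * A ^ m))\<^sup>2"
    using Suc.IH[of "X - {x}"] Suc.prems x pos
    by (intro mult_mono power_mono) (auto intro!: prod_nonneg)
  also have "\<dots> = (fact (Suc m) * B ^ Suc m)\<^sup>2 * (A ^ (m * (m - 1)) * (A ^ m)\<^sup>2)"
    by (simp add: power_mult_distrib mult_ac)
  also have "A ^ (m * (m - 1)) * (A ^ m)\<^sup>2 = A ^ (Suc m * (Suc m - 1))"
  proof -
    have "m * (m - 1) + m * 2 = Suc m * (Suc m - 1)" by (cases m) (auto simp: algebra_simps)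
    then show ?thesis by (metis power_add power_mult)
  qed
  finally show ?case .
qed

text \<open>Division of the degree by \<open>N\<close> with remainder: take a power of \<open>P\<close> times fewer than \<open>N\<close> factors
  \<open>z\<close>, whose effect is absorbed in the constant \<open>B\<close>.\<close>

lemma monic_polys_of_all_degrees:
  fixes P :: "complex poly"
  assumes P: "degree P = N" "N \<ge> 1" "lead_coeff P = 1" "\<And>z. z \<in> K \<Longrightarrow> cmod (poly P z) \<le> A ^ N"
    and K: "bounded K" and A: "A > 0"
  obtains B where "B > 0" "\<And>k. \<exists>q :: complex poly. degree q = k \<and> lead_coeff q = 1 \<and>
      (\<forall>z\<in>K. cmod (poly q z) \<le> B * A ^ k)"
proof -
  obtain R where R: "R > 0" "\<And>z. z \<in> K \<Longrightarrow> cmod z \<le> R"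
    using K unfolding bounded_pos by blast
  define Q where "Q = max 1 (R / A)"
  have Q: "Q \<ge> 1" "R \<le> Q * A" using A by (auto simp: Q_def field_simps max_def)
  show ?thesis
  proof
    show "Q ^ N > 0" using Q by simp
    fix k
    let ?q = "[:0, 1:] ^ (k mod N) * P ^ (k div N)"
    have Pn0: "P \<noteq> 0" using P by auto
    have "degree ?q = k"
      using Pn0 P(1) by (simp add: degree_mult_eq degree_power_eq)
    moreover have "lead_coeff ?q = 1"
      by (simp add: lead_coeff_mult lead_coeff_power P(3) del: pCons_0_0)
    moreover have "cmod (poly ?q z) \<le> Q ^ N * A ^ k" if z: "z \<in> K" for z
    proof -
      have "cmod (poly ?q z) = cmod z ^ (k mod N) * cmod (poly P z) ^ (k div N)"
        by (simp add: norm_mult norm_power)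
      also have "\<dots> \<le> (Q * A) ^ (k mod N) * (A ^ N) ^ (k div N)"
        using R(2)[OF z] P(4)[OF z] Q A by (intro mult_mono power_mono) auto
      also have "\<dots> = Q ^ (k mod N) * A ^ (k mod N + N * (k div N))"
        by (simp only: power_mult_distrib power_add power_mult mult.assoc)
      also have "\<dots> = Q ^ (k mod N) * A ^ k" by simp
      also have "\<dots> \<le> Q ^ N * A ^ k"
        using Q A P(2) by (intro mult_right_mono power_increasing) (auto intro: less_imp_le)
      finally show ?thesis .
    qed
    ultimately show "\<exists>q :: complex poly. degree q = k \<and> lead_coeff q = 1 \<and>
      (\<forall>z\<in>K. cmod (poly q z) \<le> Q ^ N * A ^ k)" by blast
  qed
qed

section \<open>Lower bounds for the energy of a measure\<close>

lemma (in prob_space) ex_le_nn_integral: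
  assumes K: "K \<in> sets M" "emeasure M K = 1" and f[measurable]: "f \<in> borel_measurable M"
  shows "\<exists>x\<in>K. f x \<le> (\<integral>\<^sup>+x. f x \<partial>M)"
proof (rule ccontr)
  define I where "I = (\<integral>\<^sup>+x. f x \<partial>M)"
  assume "\<not> ?thesis"
  then have less: "\<And>x. x \<in> K \<Longrightarrow> I < f x" by (auto simp: I_def not_le)
  have AE: "AE x in M. x \<in> K"
    using K by (intro AE_prob_1) (auto simp: emeasure_eq_measure)
  have "K \<noteq> {}" using K by auto
  then have I: "I \<noteq> top" using less by fastforce
  have "(\<integral>\<^sup>+x. f x - I \<partial>M) = (\<integral>\<^sup>+x. f x \<partial>M) - (\<integral>\<^sup>+x. I \<partial>M)"
    by (rule nn_integral_diff) (use I AE less in \<open>auto simp: emeasure_space_1 less_imp_le\<close>)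
  also have "\<dots> = 0" using I by (simp add: I_def emeasure_space_1)
  finally have "AE x in M. f x - I = 0" by (subst (asm) nn_integral_0_iff_AE) auto
  with AE have "AE x in M. False"
  proof eventually_elim
    case (elim x)
    then show ?case using less[of x] by (simp add: diff_eq_0_iff_ennreal not_le[symmetric])
  qed
  then show False by (simp add: AE_False)
qed

lemma ln_le_of_le_exp: "0 < x \<Longrightarrow> x \<le> exp b \<Longrightarrow> ln x \<le> (b::real)"
  by (metis exp_le_cancel_iff exp_ln)

text \<open>The average of the discrete energy over \<open>n\<close> independent random points is \<open>n (n - 1) J\<close>, so
  some choice does no worse. The points are found one after the other by the method of conditional
  expectations: with \<open>m\<close> points still to come, the induction hypothesis adds to the energy of
  the points chosen so far their expected interaction with the coming ones. New points are automatically
  distinct from old ones because the kernel is infinite on the diagonal.\<close>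

lemma (in prob_space) ex_finite_set_small_energy:
  fixes k :: "'a \<Rightarrow> 'a \<Rightarrow> ennreal"
  assumes K: "K \<in> sets M" "emeasure M K = 1"
    and [measurable]: "case_prod k \<in> borel_measurable (M \<Otimes>\<^sub>M M)"
    and sym: "\<And>x y. k x y = k y x" and diag: "\<And>x. k x x = \<infinity>"
    and fin: "(\<integral>\<^sup>+x. \<integral>\<^sup>+y. k x y \<partial>M \<partial>M) = ennreal J" and J: "J \<ge> 0"
  shows "\<exists>X. finite X \<and> X \<subseteq> K \<and> card X = n \<and>
      (\<Sum>x\<in>X. \<Sum>y\<in>X - {x}. k x y) \<le> ennreal (real (n * (n - 1)) * J)"
proof -
  define p where "p x = (\<integral>\<^sup>+y. k x y \<partial>M)" for x
  have p_meas[measurable]: "p \<in> borel_measurable M" unfolding p_def by measurable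
  have p_int: "(\<integral>\<^sup>+x. p x \<partial>M) = ennreal J" using fin by (simp add: p_def)
  have KM: "K \<subseteq> space M" using K(1) by (rule sets.sets_into_space)
  have "\<exists>X. finite X \<and> X \<subseteq> K \<and> card X = n \<and>
      (\<Sum>x\<in>X. \<Sum>y\<in>X - {x}. k x y) + of_nat (2 * m) * (\<Sum>x\<in>X. p x)
        \<le> ennreal (real (n * (n - 1) + 2 * m * n) * J)" for m
  proof (induction n arbitrary: m)
    case 0
    then show ?case by (intro exI[of _ "{}"]) auto
  next
    case (Suc n)
    obtain X where X: "finite X" "X \<subseteq> K" "card X = n" and
      le: "(\<Sum>x\<in>X. \<Sum>y\<in>X - {x}. k x y) + of_nat (2 * Suc m) * (\<Sum>x\<in>X. p x)
        \<le> ennreal (real (n * (n - 1) + 2 * Suc m * n) * J)"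
      using Suc[of "Suc m"] by blast
    define E where "E = (\<Sum>x\<in>X. \<Sum>y\<in>X - {x}. k x y)"
    define f where "f x = E + of_nat (2 * m) * (\<Sum>y\<in>X. p y) + 2 * (\<Sum>y\<in>X. k y x) + of_nat (2 * m) * p x" for x
    have [measurable]: "(\<lambda>x. k y x) \<in> borel_measurable M" if "y \<in> X" for y
    proof -
      have "y \<in> space M" using that X KM by blast
      then show ?thesis by measurable
    qed
    have [measurable]: "(\<lambda>x. \<Sum>y\<in>X. k y x) \<in> borel_measurable M"
      by (rule borel_measurable_sum) measurable
    have f_meas[measurable]: "f \<in> borel_measurable M" unfolding f_def by measurable
    have "(\<integral>\<^sup>+x. f x \<partial>M) = E + of_nat (2 * m) * (\<Sum>y\<in>X. p y) + 2 * (\<Sum>y\<in>X. p y) + of_nat (2 * m) * ennreal J"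
      unfolding f_def
      by (simp add: nn_integral_add nn_integral_cmult nn_integral_sum emeasure_space_1 p_int p_def[symmetric])
    also have "\<dots> = (E + of_nat (2 * Suc m) * (\<Sum>y\<in>X. p y)) + of_nat (2 * m) * ennreal J"
      by (simp add: algebra_simps mult_2_right)
    also have "\<dots> \<le> ennreal (real (n * (n - 1) + 2 * Suc m * n) * J) + of_nat (2 * m) * ennreal J"
      using le unfolding E_def by (rule add_right_mono)
    also have "\<dots> = ennreal (real (n * (n - 1) + 2 * Suc m * n) * J + real (2 * m) * J)"
      using J by (simp add: ennreal_mult ennreal_of_nat_eq_real_of_nat ennreal_plus)
    also have "real (n * (n - 1) + 2 * Suc m * n) * J + real (2 * m) * J =
        real (Suc n * (Suc n - 1) + 2 * m * Suc n) * J"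
      by (cases n) (auto simp: algebra_simps)
    finally have int_f: "(\<integral>\<^sup>+x. f x \<partial>M) \<le> ennreal (real (Suc n * (Suc n - 1) + 2 * m * Suc n) * J)" .
    obtain x where x: "x \<in> K" "f x \<le> (\<integral>\<^sup>+x. f x \<partial>M)" using ex_le_nn_integral[OF K f_meas] by blast
    have fx: "f x \<le> ennreal (real (Suc n * (Suc n - 1) + 2 * m * Suc n) * J)"
      using x(2) int_f by (rule order_trans)
    have "x \<notin> X"
    proof
      assume "x \<in> X"
      then have "(\<Sum>y\<in>X. k y x) = \<infinity>"
        using X(1) diag[of x] by (auto simp: ennreal_sum_eq_top)
      then have "f x = \<infinity>" by (simp add: f_def ennreal_mult_top)
      then show False using fx by (simp add: top_unique)
    qed
    have "(\<Sum>z\<in>insert x X. \<Sum>y\<in>insert x X - {z}. k z y) = E + 2 * (\<Sum>y\<in>X. k y x)"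
    proof -
      have "(\<Sum>z\<in>insert x X. \<Sum>y\<in>insert x X - {z}. k z y)
          = (\<Sum>y\<in>X. k x y) + (\<Sum>z\<in>X. \<Sum>y\<in>insert x X - {z}. k z y)"
        using \<open>x \<notin> X\<close> X(1) by (simp add: insert_Diff_if)
      also have "(\<Sum>z\<in>X. \<Sum>y\<in>insert x X - {z}. k z y) = (\<Sum>z\<in>X. k z x + (\<Sum>y\<in>X - {z}. k z y))"
        using \<open>x \<notin> X\<close> X(1) by (intro sum.cong) (auto simp: insert_Diff_if)
      also have "(\<Sum>y\<in>X. k x y) = (\<Sum>y\<in>X. k y x)" using sym by (intro sum.cong) auto
      finally show ?thesis by (simp add: E_def sum.distrib mult_2 ac_simps)
    qed
    moreover have "(\<Sum>z\<in>insert x X. p z) = (\<Sum>z\<in>X. p z) + p x"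
      using \<open>x \<notin> X\<close> X(1) by (simp add: add.commute)
    ultimately have "(\<Sum>z\<in>insert x X. \<Sum>y\<in>insert x X - {z}. k z y) + of_nat (2 * m) * (\<Sum>z\<in>insert x X. p z) = f x"
      by (simp add: f_def distrib_left ac_simps)
    then show ?case using fx X x(1) \<open>x \<notin> X\<close>
      by (intro exI[of _ "insert x X"]) auto
  qed
  from this[of 0] show ?thesis by simp
qed

text \<open>On a set of diameter at most \<open>exp b\<close> this is the logarithmic kernel plus \<open>b\<close>, which is
  nonnegative there. Energies then become integrals of one nonnegative function.\<close>

definition shifted_kernel :: "real \<Rightarrow> complex \<Rightarrow> complex \<Rightarrow> ennreal" where
  "shifted_kernel b z w = (if z = w then \<infinity> else ennreal (b - ln (cmod (z - w))))"

lemma measurable_case_prod_if_eq: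
  fixes f :: "complex \<times> complex \<Rightarrow> 'b::topological_space"
  assumes [measurable]: "f \<in> borel_measurable (borel \<Otimes>\<^sub>M borel)"
  shows "(\<lambda>(z, w). if z = w then c else f (z, w)) \<in> borel_measurable (borel \<Otimes>\<^sub>M borel)"
proof -
  have "(\<lambda>p. if cmod (fst p - snd p) = 0 then c else f p) \<in> borel_measurable (borel \<Otimes>\<^sub>M borel)"
    by measurable
  moreover have "(\<lambda>p. if cmod (fst p - snd p) = 0 then c else f p) =
      (\<lambda>(z, w). if z = w then c else f (z, w))"
    by (auto simp: fun_eq_iff)
  ultimately show ?thesis by simp
qed

lemma shifted_kernel_measurable:
  "case_prod (shifted_kernel b) \<in> borel_measurable (borel \<Otimes>\<^sub>M borel)"
proof -
  have "(\<lambda>(z, w). if z = w then \<infinity> else (\<lambda>p. ennreal (b - ln (cmod (fst p - snd p)))) (z, w))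
      \<in> borel_measurable (borel \<Otimes>\<^sub>M (borel :: complex measure))"
    by (rule measurable_case_prod_if_eq) measurable
  then show ?thesis by (simp add: shifted_kernel_def[abs_def])
qed

lemma log_kernel_measurable:
  "case_prod log_kernel \<in> borel_measurable (borel \<Otimes>\<^sub>M borel)"
proof -
  have "(\<lambda>(z, w). if z = w then \<infinity> else (\<lambda>p. ereal (- ln (cmod (fst p - snd p)))) (z, w))
      \<in> borel_measurable (borel \<Otimes>\<^sub>M (borel :: complex measure))"
    by (rule measurable_case_prod_if_eq) measurable
  then show ?thesis by (simp add: log_kernel_def[abs_def])
qed

lemma log_energy_eq_shifted:
  assumes \<mu>: "\<mu> \<in> prob_measures_on K" and K: "K \<in> sets borel"
    and b: "b \<ge> 0" "\<And>z w. z \<in> K \<Longrightarrow> w \<in> K \<Longrightarrow> cmod (z - w) \<le> exp b"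
  shows "log_energy \<mu> = enn2ereal (\<integral>\<^sup>+z. \<integral>\<^sup>+w. shifted_kernel b z w \<partial>\<mu> \<partial>\<mu>) - ereal b"
proof -
  interpret prob_space \<mu> using \<mu> by (simp add: prob_measures_on_def)
  have sets[measurable_cong]: "sets \<mu> = sets borel" using \<mu> by (simp add: prob_measures_on_def)
  have [measurable]: "case_prod log_kernel \<in> borel_measurable (\<mu> \<Otimes>\<^sub>M \<mu>)"
    "case_prod (shifted_kernel b) \<in> borel_measurable (\<mu> \<Otimes>\<^sub>M \<mu>)"
    using log_kernel_measurable shifted_kernel_measurable[of b]
    by (simp_all cong: measurable_cong_sets sets_pair_measure_cong add: sets)
  have AEK: "AE z in \<mu>. z \<in> K"
    using \<mu> K by (intro AE_prob_1) (auto simp: emeasure_eq_measure prob_measures_on_def)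
  define P where "P z w = e2ennreal (log_kernel z w)" for z w
  define N where "N z w = e2ennreal (- log_kernel z w)" for z w
  have [measurable]: "case_prod P \<in> borel_measurable (\<mu> \<Otimes>\<^sub>M \<mu>)" "case_prod N \<in> borel_measurable (\<mu> \<Otimes>\<^sub>M \<mu>)"
    unfolding P_def N_def by (simp_all add: split_def) measurable
  have "z \<in> space \<mu>" for z using sets_eq_imp_space_eq[OF sets] by simp
  then have [measurable]: "P z \<in> borel_measurable \<mu>" "N z \<in> borel_measurable \<mu>"
    "shifted_kernel b z \<in> borel_measurable \<mu>" for z
    by measurable
  have [measurable]: "(\<lambda>z. \<integral>\<^sup>+w. P z w \<partial>\<mu>) \<in> borel_measurable \<mu>"
    "(\<lambda>z. \<integral>\<^sup>+w. N z w \<partial>\<mu>) \<in> borel_measurable \<mu>"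
    "(\<lambda>z. \<integral>\<^sup>+w. shifted_kernel b z w \<partial>\<mu>) \<in> borel_measurable \<mu>"
    by (rule borel_measurable_nn_integral; measurable)+
  have PN: "P z w + ennreal b = shifted_kernel b z w + N z w" "N z w \<le> ennreal b" if "z \<in> K" "w \<in> K" for z w
  proof -
    have l: "ln (cmod (z - w)) \<le> b" if "z \<noteq> w"
      using b(2)[OF \<open>z \<in> K\<close> \<open>w \<in> K\<close>] that by (intro ln_le_of_le_exp) auto
    show "P z w + ennreal b = shifted_kernel b z w + N z w"
    proof (cases "z = w")
      case True
      then show ?thesis by (simp add: P_def N_def shifted_kernel_def log_kernel_def)
    next
      case False
      define l where "l = ln (cmod (z - w))"
      have "P z w = ennreal (- l)" "N z w = ennreal l" "shifted_kernel b z w = ennreal (b - l)"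
        using False by (simp_all add: P_def N_def shifted_kernel_def log_kernel_def l_def)
      then show ?thesis using l[OF False] b(1)
        by (cases "l \<ge> 0") (auto simp: l_def[symmetric] ennreal_neg algebra_simps simp flip: ennreal_plus)
    qed
    show "N z w \<le> ennreal b"
      using l by (cases "z = w") (auto simp: N_def log_kernel_def e2ennreal_neg intro!: ennreal_leI)
  qed
  have "(\<integral>\<^sup>+z. \<integral>\<^sup>+w. P z w \<partial>\<mu> \<partial>\<mu>) + ennreal b = (\<integral>\<^sup>+z. \<integral>\<^sup>+w. P z w + ennreal b \<partial>\<mu> \<partial>\<mu>)"
    by (simp add: nn_integral_add emeasure_space_1)
  also have "\<dots> = (\<integral>\<^sup>+z. \<integral>\<^sup>+w. shifted_kernel b z w + N z w \<partial>\<mu> \<partial>\<mu>)"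
  proof (rule nn_integral_cong_AE, use AEK in eventually_elim)
    fix z assume z: "z \<in> K"
    show "(\<integral>\<^sup>+w. P z w + ennreal b \<partial>\<mu>) = (\<integral>\<^sup>+w. shifted_kernel b z w + N z w \<partial>\<mu>)"
      by (rule nn_integral_cong_AE, use AEK in eventually_elim) (rule PN(1)[OF z])
  qed
  also have "\<dots> = (\<integral>\<^sup>+z. \<integral>\<^sup>+w. shifted_kernel b z w \<partial>\<mu> \<partial>\<mu>) + (\<integral>\<^sup>+z. \<integral>\<^sup>+w. N z w \<partial>\<mu> \<partial>\<mu>)"
    by (simp add: nn_integral_add)
  finally have eq: "(\<integral>\<^sup>+z. \<integral>\<^sup>+w. P z w \<partial>\<mu> \<partial>\<mu>) + ennreal b =
      (\<integral>\<^sup>+z. \<integral>\<^sup>+w. shifted_kernel b z w \<partial>\<mu> \<partial>\<mu>) + (\<integral>\<^sup>+z. \<integral>\<^sup>+w. N z w \<partial>\<mu> \<partial>\<mu>)" .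
  have "(\<integral>\<^sup>+z. \<integral>\<^sup>+w. N z w \<partial>\<mu> \<partial>\<mu>) \<le> (\<integral>\<^sup>+z. \<integral>\<^sup>+w. ennreal b \<partial>\<mu> \<partial>\<mu>)"
  proof (rule nn_integral_mono_AE, use AEK in eventually_elim)
    fix z assume z: "z \<in> K"
    show "(\<integral>\<^sup>+w. N z w \<partial>\<mu>) \<le> (\<integral>\<^sup>+w. ennreal b \<partial>\<mu>)"
      by (rule nn_integral_mono_AE, use AEK in eventually_elim) (rule PN(2)[OF z])
  qed
  then have Nfin: "(\<integral>\<^sup>+z. \<integral>\<^sup>+w. N z w \<partial>\<mu> \<partial>\<mu>) \<le> ennreal b" by (simp add: emeasure_space_1)
  define IP IN IS where "IP = (\<integral>\<^sup>+z. \<integral>\<^sup>+w. P z w \<partial>\<mu> \<partial>\<mu>)" and "IN = (\<integral>\<^sup>+z. \<integral>\<^sup>+w. N z w \<partial>\<mu> \<partial>\<mu>)"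
    and "IS = (\<integral>\<^sup>+z. \<integral>\<^sup>+w. shifted_kernel b z w \<partial>\<mu> \<partial>\<mu>)"
  have "enn2ereal (IP + ennreal b) = enn2ereal (IS + IN)" using eq by (simp add: IP_def IN_def IS_def)
  then have e: "enn2ereal IP + ereal b = enn2ereal IS + enn2ereal IN"
    using b(1) by (simp add: plus_ennreal.rep_eq enn2ereal_ennreal)
  have "enn2ereal IN \<le> enn2ereal (ennreal b)" using Nfin by (simp add: IN_def less_eq_ennreal.rep_eq)
  then have "enn2ereal IN \<le> ereal b" "0 \<le> enn2ereal IN" using b(1) by (simp_all add: enn2ereal_ennreal)
  with e have "enn2ereal IP - enn2ereal IN = enn2ereal IS - ereal b"
    by (cases "enn2ereal IP"; cases "enn2ereal IN"; cases "enn2ereal IS") auto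
  then show ?thesis by (simp add: log_energy_def IP_def IN_def IS_def P_def N_def)
qed

lemma ex_diameter_bound:
  fixes K :: "complex set"
  assumes "bounded K"
  obtains b where "b \<ge> 0" "\<And>z w. z \<in> K \<Longrightarrow> w \<in> K \<Longrightarrow> cmod (z - w) \<le> exp b"
proof -
  obtain R where R: "R > 0" "\<And>z. z \<in> K \<Longrightarrow> cmod z \<le> R"
    using assms unfolding bounded_pos by blast
  show ?thesis
  proof
    show "(0::real) \<le> 2 * R" using R by simp
    fix z w assume "z \<in> K" "w \<in> K"
    then have "cmod (z - w) \<le> 2 * R" using norm_triangle_ineq4[of z w] R(2)[of z] R(2)[of w] by linarith
    also have "\<dots> \<le> exp (2 * R)" using exp_ge_add_one_self[of "2 * R"] by linarith
    finally show "cmod (z - w) \<le> exp (2 * R)" .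
  qed
qed

text \<open>A set of \<open>n\<close> points found for \<open>\<mu>\<close> has discrete energy at most \<open>n (n - 1)\<close> times that of \<open>\<mu>\<close>,
  whereas the bound on the product of distances forces it to be at least about
  \<open>- n (n - 1) ln A\<close>. Divide by \<open>n (n - 1)\<close> and let \<open>n\<close> grow.\<close>

lemma log_energy_ge:
  assumes K: "compact K" and q: "\<And>k. \<exists>q :: complex poly. degree q = k \<and> lead_coeff q = 1 \<and>
      (\<forall>z\<in>K. cmod (poly q z) \<le> B * A ^ k)"
    and pos: "A > 0" "B > 0" and \<mu>: "\<mu> \<in> prob_measures_on K"
  shows "log_energy \<mu> \<ge> ereal (- ln A)"
proof -
  obtain b where b: "b \<ge> 0" "\<And>z w. z \<in> K \<Longrightarrow> w \<in> K \<Longrightarrow> cmod (z - w) \<le> exp b"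
    using ex_diameter_bound[OF compact_imp_bounded[OF K]] by blast
  have Kb: "K \<in> sets borel" using K by (simp add: borel_compact)
  interpret prob_space \<mu> using \<mu> by (simp add: prob_measures_on_def)
  have sets: "sets \<mu> = sets borel" using \<mu> by (simp add: prob_measures_on_def)
  have K\<mu>: "K \<in> sets \<mu>" "emeasure \<mu> K = 1" using Kb \<mu> sets by (auto simp: prob_measures_on_def)
  define I where "I = (\<integral>\<^sup>+z. \<integral>\<^sup>+w. shifted_kernel b z w \<partial>\<mu> \<partial>\<mu>)"
  have meas: "case_prod (shifted_kernel b) \<in> borel_measurable (\<mu> \<Otimes>\<^sub>M \<mu>)"
    using shifted_kernel_measurable[of b]
    by (simp cong: measurable_cong_sets sets_pair_measure_cong add: sets)
  have sym: "shifted_kernel b x y = shifted_kernel b y x" for x y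
    by (simp add: shifted_kernel_def norm_minus_commute)
  have diag: "shifted_kernel b x x = \<infinity>" for x by (simp add: shifted_kernel_def)
  have "ereal (b - ln A) \<le> enn2ereal I"
  proof (cases I)
    case (real J)
    then have I_real: "(\<integral>\<^sup>+z. \<integral>\<^sup>+w. shifted_kernel b z w \<partial>\<mu> \<partial>\<mu>) = ennreal J" "J \<ge> 0"
      by (simp_all add: I_def)
    have "b - ln A \<le> J + (2 * (n * ln n + n * ln B)) / (n * (n - 1))" if n: "n \<ge> 2" for n :: nat
    proof -
      obtain X where X: "finite X" "X \<subseteq> K" "card X = n"
        "(\<Sum>x\<in>X. \<Sum>y\<in>X - {x}. shifted_kernel b x y) \<le> ennreal (real (n * (n - 1)) * J)"
        using ex_finite_set_small_energy[OF K\<mu> meas sym diag I_real, of n] by blast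
      have bl: "0 \<le> b - ln (cmod (x - y))" if "x \<in> X" "y \<in> X - {x}" for x y
        using b(2)[of x y] that X(2) ln_le_of_le_exp[of "cmod (x - y)" b] by auto
      have "(\<Sum>x\<in>X. \<Sum>y\<in>X - {x}. shifted_kernel b x y) = (\<Sum>x\<in>X. \<Sum>y\<in>X - {x}. ennreal (b - ln (cmod (x - y))))"
        by (intro sum.cong) (auto simp: shifted_kernel_def)
      also have "\<dots> = ennreal (\<Sum>x\<in>X. \<Sum>y\<in>X - {x}. b - ln (cmod (x - y)))"
      proof -
        have "(\<Sum>y\<in>X - {x}. ennreal (b - ln (cmod (x - y)))) =
            ennreal (\<Sum>y\<in>X - {x}. b - ln (cmod (x - y)))" if "x \<in> X" for x
          by (rule sum_ennreal) (use bl that in blast)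
        moreover have "(\<Sum>x\<in>X. ennreal (\<Sum>y\<in>X - {x}. b - ln (cmod (x - y)))) =
            ennreal (\<Sum>x\<in>X. \<Sum>y\<in>X - {x}. b - ln (cmod (x - y)))"
          by (rule sum_ennreal) (use bl in \<open>blast intro: sum_nonneg\<close>)
        ultimately show ?thesis by simp
      qed
      finally have "(\<Sum>x\<in>X. \<Sum>y\<in>X - {x}. b - ln (cmod (x - y))) \<le> real (n * (n - 1)) * J"
        using X(4) real by (simp add: ennreal_le_iff)
      moreover have "(\<Sum>x\<in>X. \<Sum>y\<in>X - {x}. b - ln (cmod (x - y))) = real (n * (n - 1)) * b - ln (distance_product X)"
      proof -
        have "ln (distance_product X) = (\<Sum>x\<in>X. \<Sum>y\<in>X - {x}. ln (cmod (x - y)))"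
          unfolding distance_product_def by (subst ln_prod) (auto simp: X(1) intro!: sum.cong prod_pos ln_prod)
        moreover have "(\<Sum>x\<in>X. \<Sum>y\<in>X - {x}. b) = real (n * (n - 1)) * b"
          using X n by (simp add: of_nat_diff)
        ultimately show ?thesis by (simp add: sum_subtractf)
      qed
      moreover have "ln (distance_product X) \<le> 2 * (n * ln n + n * ln B) + real (n * (n - 1)) * ln A"
      proof -
        have "distance_product X > 0" unfolding distance_product_def by (intro prod_pos) auto
        then have "ln (distance_product X) \<le> ln ((fact n * B ^ n)\<^sup>2 * A ^ (n * (n - 1)))"
          using distance_product_le[OF q _ _ X(1-3)] pos by (intro ln_mono) auto
        also have "\<dots> = 2 * (ln (fact n) + n * ln B) + real (n * (n - 1)) * ln A"
          using pos by (simp add: ln_mult ln_realpow)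
        also have "ln (fact n) \<le> n * ln n"
        proof -
          have "(fact n :: real) \<le> real n ^ n" using fact_le_power[of n, where 'a = real] by simp
          then have "ln (fact n) \<le> ln (real n ^ n)" by (intro ln_mono) auto
          then show ?thesis using n by (simp add: ln_realpow)
        qed
        finally show ?thesis by simp
      qed
      ultimately have le: "real (n * (n - 1)) * (b - ln A) \<le> real (n * (n - 1)) * J + 2 * (n * ln n + n * ln B)"
        by (simp add: right_diff_distrib)
      have pos': "real (n * (n - 1)) > 0" using n by auto
      have "b - ln A \<le> (real (n * (n - 1)) * J + 2 * (n * ln n + n * ln B)) / real (n * (n - 1))"
        using le by (simp only: pos_le_divide_eq[OF pos'] mult.commute[of _ "b - ln A"])
      also have "\<dots> = J + 2 * (n * ln n + n * ln B) / real (n * (n - 1))"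
        using n by (simp add: add_divide_distrib)
      also have "real (n * (n - 1)) = real n * (real n - 1)" using n by (simp add: of_nat_diff)
      finally show ?thesis using n by (simp add: of_nat_diff)
    qed
    moreover have "(\<lambda>n::nat. J + (2 * (n * ln n + n * ln B)) / (n * (real n - 1))) \<longlonglongrightarrow> J"
      by real_asymp
    ultimately have "b - ln A \<le> J"
      by (intro tendsto_lowerbound[of _ J sequentially]) (auto simp: eventually_sequentially of_nat_diff intro!: exI[of _ 2])
    then show ?thesis using real by (simp add: enn2ereal_ennreal)
  qed simp
  then have "ereal (b - ln A) - ereal b \<le> enn2ereal I - ereal b" by (rule ereal_minus_mono) simp
  then show ?thesis using log_energy_eq_shifted[OF \<mu> Kb b] by (simp add: I_def)
qed

lemma log_capacity_le_of_small_polys: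
  assumes K: "compact K" and q: "\<And>k. \<exists>q :: complex poly. degree q = k \<and> lead_coeff q = 1 \<and>
      (\<forall>z\<in>K. cmod (poly q z) \<le> B * A ^ k)"
    and pos: "A > 0" "B > 0"
  shows "min_log_energy K \<ge> ereal (- ln A)" "log_capacity K \<le> A"
proof -
  show ge: "min_log_energy K \<ge> ereal (- ln A)"
    unfolding min_log_energy_def by (intro INF_greatest log_energy_ge[OF assms])
  show "log_capacity K \<le> A"
  proof (cases "min_log_energy K")
    case (real r)
    then have "- ln A \<le> r" using ge by simp
    then have "exp (- r) \<le> exp (ln A)" by simp
    then show ?thesis using real pos by (simp add: log_capacity_def)
  qed (use ge pos in \<open>auto simp: log_capacity_def\<close>)
qed

section \<open>A continuous curve through a bounded plane set\<close>

text \<open>Schoenberg's construction of a space-filling curve. The function \<open>plateau\<close> is continuous, has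
  period \<open>2\<close>, vanishes on \<open>[0, 1/3]\<close> and equals \<open>1\<close> on \<open>[2/3, 1]\<close>; at \<open>3\<^sup>m t\<close> it reads off whether
  the ternary digit number \<open>m\<close> of a point \<open>t\<close> of the Cantor set is \<open>0\<close> or \<open>2\<close>. The even
  digits encode the binary digits of one coordinate, the odd digits those of the other.\<close>

definition plateau :: "real \<Rightarrow> real" where
  "plateau t = min 1 (max 0 (1 / 2 - cos (pi * t)))"

definition coordinate_curve :: "real \<Rightarrow> real \<Rightarrow> real" where
  "coordinate_curve c t = (\<Sum>k. plateau (c * 9 ^ k * t) / 2 ^ Suc k)"

lemma continuous_coordinate_curve: "continuous_on UNIV (coordinate_curve c)"
proof -
  have plateau_cont: "continuous_on UNIV plateau"
    unfolding plateau_def by (intro continuous_intros)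
  have "uniform_limit UNIV (\<lambda>n t. \<Sum>k<n. plateau (c * 9 ^ k * t) / 2 ^ Suc k)
      (\<lambda>t. \<Sum>k. plateau (c * 9 ^ k * t) / 2 ^ Suc k) sequentially"
  proof (rule Weierstrass_m_test)
    show "norm (plateau (c * 9 ^ k * t) / 2 ^ Suc k) \<le> (1 / 2) ^ Suc k" for k t
      by (auto simp: plateau_def field_simps power_divide)
    show "summable (\<lambda>k. (1 / 2 :: real) ^ Suc k)"
      by (rule summable_ignore_initial_segment[of _ 1, simplified]) (simp add: summable_geometric)
  qed
  moreover have "\<forall>\<^sub>F n in sequentially. continuous_on UNIV (\<lambda>t. \<Sum>k<n. plateau (c * 9 ^ k * t) / 2 ^ Suc k)"
    by (intro always_eventually allI continuous_intros continuous_on_compose2[OF plateau_cont]) auto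
  ultimately show ?thesis
    unfolding coordinate_curve_def[abs_def] by (intro uniform_limit_theorem) auto
qed

lemma binary_expansion:
  assumes "0 \<le> x" "x < (1::real)"
  obtains b :: "nat \<Rightarrow> real" where "\<And>k. b k = 0 \<or> b k = 1" "(\<lambda>k. b k / 2 ^ Suc k) sums x"
proof
  define f where "f n = real_of_int \<lfloor>2 ^ n * x\<rfloor>" for n :: nat
  define b where "b k = f (Suc k) - 2 * f k" for k
  show "b k = 0 \<or> b k = 1" for k
  proof -
    have x2: "2 ^ Suc k * x = 2 * (2 ^ k * x)" by simp
    have "2 * f k \<le> 2 ^ Suc k * x" "2 ^ Suc k * x < 2 * f k + 2"
      unfolding f_def x2 by linarith+
    then have "\<lfloor>2 ^ Suc k * x\<rfloor> = 2 * \<lfloor>2 ^ k * x\<rfloor> \<or> \<lfloor>2 ^ Suc k * x\<rfloor> = 2 * \<lfloor>2 ^ k * x\<rfloor> + 1"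
      unfolding f_def by linarith
    then show ?thesis by (auto simp: b_def f_def)
  qed
  have sum: "(\<Sum>k<n. b k / 2 ^ Suc k) = f n / 2 ^ n" for n
  proof (induction n)
    case 0
    have "\<lfloor>x\<rfloor> = 0" using assms by linarith
    then show ?case by (simp add: f_def)
  qed (simp add: b_def field_simps)
  have lim: "(\<lambda>n. x - 1 / 2 ^ n) \<longlonglongrightarrow> x" by real_asymp
  have bds: "x - 1 / 2 ^ n \<le> f n / 2 ^ n" "f n / 2 ^ n \<le> x" for n
  proof -
    have "2 ^ n * x - 1 \<le> f n" "f n \<le> 2 ^ n * x" unfolding f_def by linarith+
    then have "(2 ^ n * x - 1) / 2 ^ n \<le> f n / 2 ^ n" "f n / 2 ^ n \<le> (2 ^ n * x) / 2 ^ n"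
      by (intro divide_right_mono; simp)+
    then show "x - 1 / 2 ^ n \<le> f n / 2 ^ n" "f n / 2 ^ n \<le> x" by (simp_all add: diff_divide_distrib)
  qed
  have "(\<lambda>n. f n / 2 ^ n) \<longlonglongrightarrow> x"
    by (rule tendsto_sandwich[OF _ _ lim tendsto_const]) (simp_all add: bds)
  then show "(\<lambda>k. b k / 2 ^ Suc k) sums x" unfolding sums_def sum .
qed

text \<open>The digits before position \<open>m\<close> contribute an even integer to \<open>3\<^sup>m t\<close> and disappear by
  periodicity; the digits after it contribute at most \<open>1/3\<close> and stay within the plateau.\<close>

lemma plateau_ternary:
  fixes d :: "nat \<Rightarrow> real"
  assumes d: "\<And>k. d k = 0 \<or> d k = 1"
  defines "t \<equiv> \<Sum>k. 2 * d k / 3 ^ Suc k"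
  shows "plateau (3 ^ m * t) = d m" "0 \<le> t" "t \<le> 1"
proof -
  have geo: "(\<lambda>k. 2 / 3 ^ Suc k :: real) sums 1"
  proof -
    have "(\<lambda>k. 2 / 3 * (1 / 3 :: real) ^ k) sums (2 / 3 * (1 / (1 - 1 / 3)))"
      by (intro sums_mult geometric_sums) simp
    then show ?thesis by (simp add: power_divide field_simps)
  qed
  have bnds: "0 \<le> 2 * d k / 3 ^ Suc k" "2 * d k / 3 ^ Suc k \<le> 2 / 3 ^ Suc k" for k
    using d[of k] by auto
  have summ: "summable (\<lambda>k. 2 * d k / 3 ^ Suc k)"
    by (rule summable_comparison_test'[OF sums_summable[OF geo], of 0]) (simp only: real_norm_def abs_of_nonneg bnds)
  show "0 \<le> t" unfolding t_def using summ bnds by (intro suminf_nonneg) auto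
  show "t \<le> 1" unfolding t_def using sums_unique[OF geo] suminf_le[OF bnds(2) summ sums_summable[OF geo]] by simp
  define r where "r = (\<Sum>k. 2 * d (k + Suc m) / 3 ^ Suc k)"
  have bnds': "0 \<le> 2 * d (k + Suc m) / 3 ^ Suc k" "2 * d (k + Suc m) / 3 ^ Suc k \<le> 2 / 3 ^ Suc k" for k
    using d[of "k + Suc m"] by auto
  have summ': "summable (\<lambda>k. 2 * d (k + Suc m) / 3 ^ Suc k)"
    by (rule summable_comparison_test'[OF sums_summable[OF geo], of 0]) (simp only: real_norm_def abs_of_nonneg bnds')
  have r: "0 \<le> r" "r \<le> 1" unfolding r_def
    using summ' bnds' suminf_le[OF bnds'(2) summ' sums_summable[OF geo]] sums_unique[OF geo]
    by (auto intro!: suminf_nonneg)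
  have "t = (\<Sum>k. 2 * d (k + Suc m) / 3 ^ Suc (k + Suc m)) + (\<Sum>k<Suc m. 2 * d k / 3 ^ Suc k)"
    unfolding t_def by (rule suminf_split_initial_segment[OF summ])
  also have "(\<lambda>k. 2 * d (k + Suc m) / 3 ^ Suc (k + Suc m)) = (\<lambda>k. (1 / 3 ^ Suc m) * (2 * d (k + Suc m) / 3 ^ Suc k))"
    by (auto simp: power_add)
  also have "(\<Sum>k. (1 / 3 ^ Suc m) * (2 * d (k + Suc m) / 3 ^ Suc k)) = (1 / 3 ^ Suc m) * r"
    unfolding r_def by (rule suminf_mult[OF summ'])
  finally have t_eq: "3 ^ m * t = 3 ^ m * (\<Sum>k<m. 2 * d k / 3 ^ Suc k) + (2 * d m + r) / 3"
    by (simp add: field_simps)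
  have "\<exists>N::int. 3 ^ m * (\<Sum>k<m. 2 * d k / 3 ^ Suc k) = 2 * of_int N" for m
  proof (induction m)
    case (Suc m)
    then obtain N where "3 ^ m * (\<Sum>k<m. 2 * d k / 3 ^ Suc k) = 2 * of_int N" by blast
    then have "3 ^ Suc m * (\<Sum>k<Suc m. 2 * d k / 3 ^ Suc k) = 2 * of_int (3 * N) + 2 * d m"
      by (simp add: field_simps)
    moreover from d[of m] have "2 * of_int (3 * N) + 2 * d m =
        2 * of_int (if d m = 0 then 3 * N else 3 * N + 1)" by auto
    ultimately show ?case by metis
  qed auto
  then obtain N :: int where "3 ^ m * (\<Sum>k<m. 2 * d k / 3 ^ Suc k) = 2 * of_int N" by blast
  then have "pi * (3 ^ m * t) = pi * ((2 * d m + r) / 3) + of_int N * (2 * pi)"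
    using t_eq by (simp add: algebra_simps)
  then have cos_eq: "cos (pi * (3 ^ m * t)) = cos (pi * ((2 * d m + r) / 3))"
    using cos.plus_of_int[of "pi * ((2 * d m + r) / 3)" N] by simp
  have c3: "cos (pi / 3) = 1 / 2" by (rule cos_60)
  from d[of m] show "plateau (3 ^ m * t) = d m"
  proof
    assume d0: "d m = 0"
    have "cos (pi / 3) \<le> cos (pi * (r / 3))"
      using r by (intro cos_monotone_0_pi_le) (auto simp: field_simps)
    then show ?thesis using c3 cos_eq d0 by (simp add: plateau_def)
  next
    assume d1: "d m = 1"
    have "cos (pi / 3) \<le> cos (pi * ((1 - r) / 3))"
      using r by (intro cos_monotone_0_pi_le) (auto simp: field_simps)
    also have "pi * ((1 - r) / 3) = pi - pi * ((2 + r) / 3)" by (simp add: field_simps)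
    finally show ?thesis using c3 cos_eq d1 by (simp add: plateau_def)
  qed
qed

lemma coordinate_curves_fill_square:
  assumes "0 \<le> x" "x < 1" "0 \<le> y" "y < 1"
  obtains t where "0 \<le> t" "t \<le> 1" "coordinate_curve 1 t = x" "coordinate_curve 3 t = y"
proof -
  obtain a where a: "\<And>k. a k = 0 \<or> a k = 1" "(\<lambda>k. a k / 2 ^ Suc k) sums x"
    using binary_expansion assms(1,2) by blast
  obtain b where b: "\<And>k. b k = 0 \<or> b k = 1" "(\<lambda>k. b k / 2 ^ Suc k) sums y"
    using binary_expansion assms(3,4) by blast
  define d where "d k = (if even k then a (k div 2) else b (k div 2))" for k
  have d: "d k = 0 \<or> d k = 1" for k using a(1) b(1) by (simp add: d_def)
  define t where "t = (\<Sum>k. 2 * d k / 3 ^ Suc k)"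
  note P = plateau_ternary[of d, OF d, folded t_def]
  have "plateau (1 * 9 ^ k * t) = a k" for k
    using P(1)[of "2 * k"] by (simp add: d_def power_mult)
  moreover have "plateau (3 * 9 ^ k * t) = b k" for k
    using P(1)[of "2 * k + 1"] by (simp add: d_def power_mult power_add)
  ultimately have "coordinate_curve 1 t = x" "coordinate_curve 3 t = y"
    unfolding coordinate_curve_def using sums_unique[OF a(2)] sums_unique[OF b(2)] by auto
  then show ?thesis using that P(2,3) by blast
qed

lemma bounded_set_in_curve:
  fixes L :: "complex set"
  assumes "bounded L"
  obtains s :: "real \<Rightarrow> complex" where "continuous_on UNIV s" "L \<subseteq> s ` {0..1}"
proof -
  obtain R where R: "R > 0" "\<And>z. z \<in> L \<Longrightarrow> cmod z \<le> R"
    using assms unfolding bounded_pos by blast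
  define s where "s t = Complex ((2 * R + 1) * coordinate_curve 1 t - R) ((2 * R + 1) * coordinate_curve 3 t - R)" for t
  show ?thesis
  proof
    show "continuous_on UNIV s" unfolding s_def Complex_eq
      by (intro continuous_intros continuous_coordinate_curve)
    show "L \<subseteq> s ` {0..1}"
    proof
      fix z assume "z \<in> L"
      then have "\<bar>Re z\<bar> \<le> R" "\<bar>Im z\<bar> \<le> R"
        using R(2)[of z] abs_Re_le_cmod[of z] abs_Im_le_cmod[of z] by linarith+
      then have "0 \<le> (Re z + R) / (2 * R + 1)" "(Re z + R) / (2 * R + 1) < 1"
        "0 \<le> (Im z + R) / (2 * R + 1)" "(Im z + R) / (2 * R + 1) < 1"
        using R(1) by (simp_all add: divide_less_eq)
      from coordinate_curves_fill_square[OF this]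
      obtain t where t: "0 \<le> t" "t \<le> 1" "coordinate_curve 1 t = (Re z + R) / (2 * R + 1)"
        "coordinate_curve 3 t = (Im z + R) / (2 * R + 1)" by metis
      then have "s t = z" using R(1) by (simp add: s_def complex_eq_iff)
      then show "z \<in> s ` {0..1}" using t by auto
    qed
  qed
qed

section \<open>Measures of small energy as weak limits of point masses\<close>

text \<open>The minimum of \<open>T\<close> and the shifted kernel, written so that its continuity, also on the
  diagonal, is visible.\<close>

definition truncated_kernel :: "real \<Rightarrow> real \<Rightarrow> complex \<Rightarrow> complex \<Rightarrow> ennreal" where
  "truncated_kernel b T z w = ennreal (b - ln (max (cmod (z - w)) (exp (b - T))))"

lemma truncated_kernel_continuous:
  "(p \<longlongrightarrow> z) F \<Longrightarrow> (q \<longlongrightarrow> w) F \<Longrightarrow>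
    ((\<lambda>n. truncated_kernel b T (p n) (q n)) \<longlongrightarrow> truncated_kernel b T z w) F"
  unfolding truncated_kernel_def
  by (intro tendsto_intros tendsto_ennrealI) (auto simp: max_def not_le intro: order.strict_trans[OF exp_gt_zero])

lemma truncated_kernel_measurable[measurable]:
  "case_prod (truncated_kernel b T) \<in> borel_measurable (borel \<Otimes>\<^sub>M borel)"
  unfolding truncated_kernel_def[abs_def] by measurable

lemma truncated_kernel_mono: "T \<le> T' \<Longrightarrow> truncated_kernel b T z w \<le> truncated_kernel b T' z w"
  unfolding truncated_kernel_def
  by (intro ennreal_leI diff_left_mono ln_mono max.mono) (auto simp: less_max_iff_disj)

lemma shifted_kernel_le_SUP_truncated:
  "shifted_kernel b z w \<le> (SUP T::nat. truncated_kernel b T z w)"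
proof (cases "z = w")
  case True
  then have "truncated_kernel b T z w = ennreal T" for T :: real
    by (simp add: truncated_kernel_def max_def not_le)
  then have "(SUP T::nat. truncated_kernel b T z w) = (SUP T::nat. of_nat T)"
    by (simp only: ennreal_of_nat_eq_real_of_nat)
  then show ?thesis by (simp only: ennreal_SUP_of_nat_eq_top top_greatest)
next
  case False
  define T where "T = nat \<lceil>b - ln (cmod (z - w))\<rceil>"
  have "b - T \<le> ln (cmod (z - w))" unfolding T_def by linarith
  then have "exp (b - T) \<le> exp (ln (cmod (z - w)))" by simp
  then have "exp (b - T) \<le> cmod (z - w)" using False by simp
  then have "truncated_kernel b T z w = shifted_kernel b z w"
    using False by (simp add: truncated_kernel_def shifted_kernel_def max_def)
  then show ?thesis by (metis SUP_upper UNIV_I)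
qed

text \<open>Adding the point \<open>x N\<close> contributes its interaction with the earlier points twice and the
  diagonal term \<open>T\<close> once.\<close>

lemma sum_truncated_kernel_le:
  assumes x: "inj x" and a: "\<And>n. real n * a \<le> (\<Sum>i<n. ln (cmod (x n - x i)))"
    and b: "\<And>i j. cmod (x i - x j) \<le> exp b" and T: "T \<ge> 0"
  shows "(\<Sum>i<N. \<Sum>j<N. truncated_kernel b T (x i) (x j))
    \<le> ennreal (real N * T + real N * (real N - 1) * (b - a))"
proof -
  define g where "g i j = b - ln (max (cmod (x i - x j)) (exp (b - T)))" for i j
  have g_nonneg: "g i j \<ge> 0" for i j
  proof -
    have "max (cmod (x i - x j)) (exp (b - T)) \<le> exp b" using b T by auto
    then have "ln (max (cmod (x i - x j)) (exp (b - T))) \<le> b"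
      by (intro ln_le_of_le_exp) (auto simp: less_max_iff_disj)
    then show ?thesis by (simp add: g_def)
  qed
  have g_sym: "g i j = g j i" for i j by (simp add: g_def norm_minus_commute)
  have g_diag: "g i i = T" for i by (simp add: g_def max_def not_le)
  have g_le: "g i j \<le> b - ln (cmod (x i - x j))" if "i \<noteq> j" for i j
  proof -
    have "cmod (x i - x j) > 0" using x that by (auto dest: injD)
    then show ?thesis unfolding g_def by (intro diff_left_mono ln_mono) auto
  qed
  have "(\<Sum>i<N. \<Sum>j<N. g i j) \<le> real N * T + real N * (real N - 1) * (b - a)"
  proof (induction N)
    case (Suc N)
    have row: "(\<Sum>j<N. g N j) \<le> real N * (b - a)"
    proof -
      have "(\<Sum>j<N. g N j) \<le> (\<Sum>j<N. b - ln (cmod (x N - x j)))" by (intro sum_mono g_le) auto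
      also have "\<dots> \<le> real N * (b - a)" using a[of N] by (simp add: sum_subtractf right_diff_distrib)
      finally show ?thesis .
    qed
    have "(\<Sum>i<Suc N. \<Sum>j<Suc N. g i j) = (\<Sum>i<N. \<Sum>j<N. g i j) + (\<Sum>i<N. g i N) + (\<Sum>j<N. g N j) + g N N"
      by (simp add: sum.distrib)
    also have "(\<Sum>i<N. g i N) = (\<Sum>j<N. g N j)" using g_sym by simp
    finally have "(\<Sum>i<Suc N. \<Sum>j<Suc N. g i j) \<le>
        (real N * T + real N * (real N - 1) * (b - a)) + 2 * (real N * (b - a)) + T"
      using Suc row g_diag[of N] by linarith
    also have "\<dots> = real (Suc N) * T + real (Suc N) * (real (Suc N) - 1) * (b - a)"
      by (simp add: algebra_simps)
    finally show ?case .
  qed simp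
  moreover have "(\<Sum>i<N. \<Sum>j<N. truncated_kernel b T (x i) (x j)) = ennreal (\<Sum>i<N. \<Sum>j<N. g i j)"
  proof -
    have "(\<Sum>j<N. ennreal (g i j)) = ennreal (\<Sum>j<N. g i j)" for i
      by (rule sum_ennreal) (rule g_nonneg)
    moreover have "(\<Sum>i<N. ennreal (\<Sum>j<N. g i j)) = ennreal (\<Sum>i<N. \<Sum>j<N. g i j)"
      by (rule sum_ennreal) (intro sum_nonneg g_nonneg)
    ultimately show ?thesis by (simp add: truncated_kernel_def flip: g_def)
  qed
  ultimately show ?thesis by (simp add: ennreal_leI)
qed

definition empirical_measure :: "(nat \<Rightarrow> real) \<Rightarrow> nat \<Rightarrow> real measure" where
  "empirical_measure t n = distr (uniform_count_measure {..n}) borel t"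

lemma real_distribution_empirical: "real_distribution (empirical_measure t n)"
proof -
  interpret prob_space "uniform_count_measure {..n}" by (rule prob_space_uniform_count_measure) auto
  show ?thesis unfolding empirical_measure_def
    by (rule real_distribution_distr) (simp add: measurable_def space_uniform_count_measure sets_uniform_count_measure)
qed

lemma nn_integral_empirical:
  assumes [measurable]: "f \<in> borel_measurable borel"
  shows "(\<integral>\<^sup>+u. f u \<partial>empirical_measure t n) = (\<Sum>i\<le>n. ennreal (1 / Suc n) * f (t i))"
proof -
  have "t \<in> measurable (uniform_count_measure {..n}) borel"
    by (simp add: measurable_def space_uniform_count_measure sets_uniform_count_measure)
  then show ?thesis unfolding empirical_measure_def
    by (subst nn_integral_distr) (auto simp: uniform_count_measure_def nn_integral_point_measure_finite)
qed

text \<open>Helly's theorem supplies a weakly convergent subsequence, and Skorohod's theorem turns it into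
  pointwise convergence of random variables, to which Fatou's lemma applies.\<close>

lemma ex_weak_limit:
  assumes t: "\<And>i. t i \<in> {0..1::real}"
  obtains r \<Omega> Y_seq Y where "strict_mono (r :: nat \<Rightarrow> nat)" "prob_space (\<Omega> :: real measure)"
    "\<And>n. Y_seq n \<in> borel_measurable \<Omega>" "\<And>n. distr \<Omega> borel (Y_seq n) = empirical_measure t (r n)"
    "Y \<in> borel_measurable \<Omega>" "\<And>\<omega>. \<omega> \<in> space \<Omega> \<Longrightarrow> (\<lambda>n. Y_seq n \<omega>) \<longlonglongrightarrow> Y \<omega>"
proof -
  have "tight (empirical_measure t)"
    unfolding tight_def
  proof (intro conjI allI impI real_distribution_empirical)
    fix \<epsilon> :: real assume "\<epsilon> > 0"
    have "measure (empirical_measure t n) {-1<..1} = 1" for n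
    proof -
      have "t -` {-1<..1} \<inter> {..n} = {..n}" using t by force
      moreover have "t \<in> measurable (uniform_count_measure {..n}) borel"
        by (simp add: measurable_def space_uniform_count_measure sets_uniform_count_measure)
      ultimately show ?thesis unfolding empirical_measure_def
        by (subst measure_distr) (auto simp: space_uniform_count_measure measure_uniform_count_measure)
    qed
    then show "\<exists>a b. a < b \<and> (\<forall>n. 1 - \<epsilon> < measure (empirical_measure t n) {a<..b})"
      using \<open>\<epsilon> > 0\<close> by (intro exI[of _ "-1"] exI[of _ 1]) auto
  qed
  from tight_imp_convergent_subsubsequence[OF this strict_mono_id]
  obtain r M where r: "strict_mono (r :: nat \<Rightarrow> nat)" "real_distribution M"
    "weak_conv_m (empirical_measure t \<circ> id \<circ> r) M" by blast
  have rd: "real_distribution ((empirical_measure t \<circ> id \<circ> r) n)" for n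
    by (simp add: real_distribution_empirical)
  from Skorohod[OF rd r(2,3)] obtain \<Omega> :: "real measure" and Y_seq Y where
    "prob_space \<Omega>" "\<forall>n. Y_seq n \<in> measurable \<Omega> borel"
    "\<forall>n. distr \<Omega> borel (Y_seq n) = (empirical_measure t \<circ> id \<circ> r) n"
    "Y \<in> measurable \<Omega> lborel" "\<forall>x\<in>space \<Omega>. (\<lambda>n. Y_seq n x) \<longlonglongrightarrow> Y x"
    by blast
  then show ?thesis using that[of r \<Omega> Y_seq Y] r(1) by simp
qed

text \<open>The measure is the image, under the curve \<open>s\<close>, of a weak limit of the counting measures of the
  lifted points. The truncated energy of the limit is bounded by Fatou's lemma; the diagonal terms
  \<open>T / N\<close> vanish in the limit, and then \<open>T\<close> tends to infinity by monotone convergence.\<close>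

lemma ex_measure_small_energy:
  assumes L: "compact L" and x: "\<And>i. x i \<in> L" "inj x"
    and a: "\<And>n. real n * a \<le> (\<Sum>i<n. ln (cmod (x n - x i)))"
  shows "\<exists>\<nu>\<in>prob_measures_on L. log_energy \<nu> \<le> ereal (- a)"
proof -
  obtain b where b: "b \<ge> 0" "\<And>z w. z \<in> L \<Longrightarrow> w \<in> L \<Longrightarrow> cmod (z - w) \<le> exp b"
    using ex_diameter_bound[OF compact_imp_bounded[OF L]] by blast
  have ab: "a \<le> b"
  proof -
    have "a \<le> ln (cmod (x 1 - x 0))" using a[of 1] by simp
    also have "\<dots> \<le> b" using b(2)[OF x(1) x(1)] x(2) by (intro ln_le_of_le_exp) (auto simp: inj_eq)
    finally show ?thesis .
  qed
  obtain s where s: "continuous_on UNIV s" "L \<subseteq> s ` {0..1::real}"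
    using bounded_set_in_curve[OF compact_imp_bounded[OF L]] by blast
  have [measurable]: "s \<in> borel_measurable borel" using s(1) by (rule borel_measurable_continuous_onI)
  have "\<exists>t. t \<in> {0..1} \<and> s t = x i" for i
    using subsetD[OF s(2) x(1)[of i]] by (metis imageE)
  then obtain t where t: "\<And>i. t i \<in> {0..1}" "\<And>i. s (t i) = x i" by metis
  obtain r \<Omega> Y_seq Y where r: "strict_mono (r :: nat \<Rightarrow> nat)" and \<Omega>: "prob_space (\<Omega> :: real measure)"
    and Yn[measurable]: "\<And>n. Y_seq n \<in> borel_measurable \<Omega>"
    and distr_Yn: "\<And>n. distr \<Omega> borel (Y_seq n) = empirical_measure t (r n)"
    and Y[measurable]: "Y \<in> borel_measurable \<Omega>"
    and lim: "\<And>\<omega>. \<omega> \<in> space \<Omega> \<Longrightarrow> (\<lambda>n. Y_seq n \<omega>) \<longlonglongrightarrow> Y \<omega>"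
    by (rule ex_weak_limit[of t, OF t(1)]) (rule that)
  interpret \<Omega>: prob_space \<Omega> by (rule \<Omega>)
  define \<nu> where "\<nu> = distr \<Omega> borel (\<lambda>\<omega>. s (Y \<omega>))"
  have Lb[measurable]: "L \<in> sets borel" using L by (simp add: borel_compact)
  have lim_s: "(\<lambda>n. s (Y_seq n \<omega>)) \<longlonglongrightarrow> s (Y \<omega>)" if "\<omega> \<in> space \<Omega>" for \<omega>
    using lim[OF that] s(1) by (auto intro: continuous_on_tendsto_compose[of UNIV s])
  have "AE \<omega> in \<Omega>. s (Y_seq n \<omega>) \<in> L" for n
  proof -
    have "AE u in empirical_measure t (r n). s u \<in> L"
    proof -
      have "t \<in> measurable (uniform_count_measure {..r n}) borel"
        by (simp add: measurable_def space_uniform_count_measure sets_uniform_count_measure)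
      then show ?thesis unfolding empirical_measure_def using t(2) x(1)
        by (subst AE_distr_iff) auto
    qed
    then show ?thesis unfolding distr_Yn[symmetric] by (subst (asm) AE_distr_iff) auto
  qed
  then have "AE \<omega> in \<Omega>. \<forall>n. s (Y_seq n \<omega>) \<in> L" by (simp add: AE_all_countable)
  then have "AE \<omega> in \<Omega>. s (Y \<omega>) \<in> L"
    using AE_space
  proof eventually_elim
    case (elim \<omega>)
    then show ?case
      using closed_sequentially[OF compact_imp_closed[OF L], of "\<lambda>n. s (Y_seq n \<omega>)"] lim_s by blast
  qed
  then have "AE z in \<nu>. z \<in> L" unfolding \<nu>_def by (subst AE_distr_iff) auto
  moreover have prob_\<nu>: "prob_space \<nu>" unfolding \<nu>_def by (rule \<Omega>.prob_space_distr) measurable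
  ultimately have "emeasure \<nu> L = 1"
    using prob_space.emeasure_eq_1_AE[OF prob_\<nu>, of L] by (simp add: \<nu>_def)
  then have \<nu>_prob: "\<nu> \<in> prob_measures_on L" using prob_\<nu> by (simp add: prob_measures_on_def \<nu>_def)
  have trunc: "(\<integral>\<^sup>+z. \<integral>\<^sup>+w. truncated_kernel b T z w \<partial>\<nu> \<partial>\<nu>) \<le> ennreal (b - a)" if T: "T \<ge> 0" for T :: real
  proof -
    let ?h = "\<lambda>u v. truncated_kernel b T (s u) (s v)"
    have hm[measurable]: "case_prod ?h \<in> borel_measurable (borel \<Otimes>\<^sub>M borel)"
      using measurable_compose[OF _ truncated_kernel_measurable[of b T], of "\<lambda>(u, v). (s u, s v)"]
      by (simp add: split_def)
    have hm': "(\<lambda>\<omega>. ?h (f \<omega>') (f \<omega>)) \<in> borel_measurable \<Omega>" if [measurable]: "f \<in> borel_measurable \<Omega>" for f \<omega>'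
      by (rule measurable_compose[OF _ hm[THEN measurable_Pair2], simplified]) auto
    have hm'': "(\<lambda>\<omega>'. \<integral>\<^sup>+\<omega>. ?h (f \<omega>') (f \<omega>) \<partial>\<Omega>) \<in> borel_measurable \<Omega>" if [measurable]: "f \<in> borel_measurable \<Omega>" for f
      by measurable
    have emp: "(\<integral>\<^sup>+\<omega>'. \<integral>\<^sup>+\<omega>. ?h (Y_seq n \<omega>') (Y_seq n \<omega>) \<partial>\<Omega> \<partial>\<Omega>) \<le> ennreal (T / Suc n + (b - a))" for n
    proof -
      let ?N = "Suc (r n)"
      have "(\<integral>\<^sup>+\<omega>'. \<integral>\<^sup>+\<omega>. ?h (Y_seq n \<omega>') (Y_seq n \<omega>) \<partial>\<Omega> \<partial>\<Omega>) =
          (\<integral>\<^sup>+u. \<integral>\<^sup>+v. ?h u v \<partial>empirical_measure t (r n) \<partial>empirical_measure t (r n))"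
        unfolding distr_Yn[symmetric] by (simp add: nn_integral_distr)
      also have "\<dots> = (\<Sum>i\<le>r n. ennreal (1 / ?N) * (\<Sum>j\<le>r n. ennreal (1 / ?N) * truncated_kernel b T (x i) (x j)))"
      proof -
        have [measurable]: "?h u \<in> borel_measurable borel" for u by measurable
        show ?thesis by (simp add: nn_integral_empirical t(2))
      qed
      also have "\<dots> = ennreal (1 / ?N) * (ennreal (1 / ?N) * (\<Sum>i<?N. \<Sum>j<?N. truncated_kernel b T (x i) (x j)))"
        by (simp add: sum_distrib_left mult.assoc lessThan_Suc_atMost del: sum.lessThan_Suc)
      also have "\<dots> \<le> ennreal (1 / ?N) * (ennreal (1 / ?N) * ennreal (real ?N * T + real ?N * (real ?N - 1) * (b - a)))"
        using b(2) x(1) T by (intro mult_left_mono sum_truncated_kernel_le[OF x(2) a]) auto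
      also have "\<dots> = ennreal (1 / ?N * (1 / ?N * (real ?N * T + real ?N * (real ?N - 1) * (b - a))))"
        by (simp only: ennreal_mult'[of "1 / real ?N"] zero_le_divide_1_iff of_nat_0_le_iff)
      also have "\<dots> \<le> ennreal (T / Suc n + (b - a))"
      proof (rule ennreal_leI)
        have "1 / ?N * (1 / ?N * (real ?N * T + real ?N * (real ?N - 1) * (b - a)))
          = T / ?N + (1 - 1 / ?N) * (b - a)"
          by (simp add: field_simps del: of_nat_Suc)
        also have "\<dots> \<le> T / Suc n + 1 * (b - a)"
          using T ab seq_suble[OF r, of n]
          by (intro add_mono mult_right_mono divide_left_mono) (auto simp del: of_nat_Suc)
        finally show "1 / ?N * (1 / ?N * (real ?N * T + real ?N * (real ?N - 1) * (b - a))) \<le> T / Suc n + (b - a)"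
          by simp
      qed
      finally show ?thesis .
    qed
    have "(\<integral>\<^sup>+z. \<integral>\<^sup>+w. truncated_kernel b T z w \<partial>\<nu> \<partial>\<nu>) = (\<integral>\<^sup>+\<omega>'. \<integral>\<^sup>+\<omega>. ?h (Y \<omega>') (Y \<omega>) \<partial>\<Omega> \<partial>\<Omega>)"
      unfolding \<nu>_def by (simp add: nn_integral_distr)
    also have "\<dots> = (\<integral>\<^sup>+\<omega>'. \<integral>\<^sup>+\<omega>. liminf (\<lambda>n. ?h (Y_seq n \<omega>') (Y_seq n \<omega>)) \<partial>\<Omega> \<partial>\<Omega>)"
      by (intro nn_integral_cong lim_imp_Liminf[symmetric] truncated_kernel_continuous lim_s) auto
    also have "\<dots> \<le> (\<integral>\<^sup>+\<omega>'. liminf (\<lambda>n. \<integral>\<^sup>+\<omega>. ?h (Y_seq n \<omega>') (Y_seq n \<omega>) \<partial>\<Omega>) \<partial>\<Omega>)"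
      by (intro nn_integral_mono nn_integral_liminf hm') measurable
    also have "\<dots> \<le> liminf (\<lambda>n. \<integral>\<^sup>+\<omega>'. \<integral>\<^sup>+\<omega>. ?h (Y_seq n \<omega>') (Y_seq n \<omega>) \<partial>\<Omega> \<partial>\<Omega>)"
      by (intro nn_integral_liminf hm'') measurable
    also have "\<dots> \<le> liminf (\<lambda>n. ennreal (T / Suc n + (b - a)))"
      by (intro Liminf_mono always_eventually allI emp)
    also have "\<dots> = ennreal (b - a)"
    proof (rule lim_imp_Liminf)
      have "(\<lambda>n. T / Suc n + (b - a)) \<longlonglongrightarrow> b - a" by real_asymp
      then show "(\<lambda>n. ennreal (T / Suc n + (b - a))) \<longlonglongrightarrow> ennreal (b - a)" by (rule tendsto_ennrealI)
    qed simp
    finally show ?thesis .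
  qed
  have sets_\<nu>[measurable_cong]: "sets \<nu> = sets borel" by (simp add: \<nu>_def)
  have tm[measurable]: "(\<lambda>w. truncated_kernel b T z w) \<in> borel_measurable \<nu>" for T z
    unfolding truncated_kernel_def by measurable
  have tm2: "case_prod (truncated_kernel b T) \<in> borel_measurable (\<nu> \<Otimes>\<^sub>M \<nu>)" for T
    using truncated_kernel_measurable by (simp cong: measurable_cong_sets sets_pair_measure_cong add: sets_\<nu>)
  have tm3[measurable]: "(\<lambda>z. \<integral>\<^sup>+w. truncated_kernel b T z w \<partial>\<nu>) \<in> borel_measurable \<nu>" for T
  proof -
    interpret \<nu>: prob_space \<nu> by (rule prob_\<nu>)
    show ?thesis by (rule \<nu>.borel_measurable_nn_integral[OF tm2])
  qed
  have "(\<integral>\<^sup>+z. \<integral>\<^sup>+w. shifted_kernel b z w \<partial>\<nu> \<partial>\<nu>)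
      \<le> (\<integral>\<^sup>+z. \<integral>\<^sup>+w. (SUP T::nat. truncated_kernel b T z w) \<partial>\<nu> \<partial>\<nu>)"
    by (intro nn_integral_mono shifted_kernel_le_SUP_truncated)
  also have "\<dots> = (\<integral>\<^sup>+z. (SUP T::nat. \<integral>\<^sup>+w. truncated_kernel b T z w \<partial>\<nu>) \<partial>\<nu>)"
    by (intro nn_integral_cong nn_integral_monotone_convergence_SUP tm)
      (auto simp: incseq_def le_fun_def intro: truncated_kernel_mono)
  also have "\<dots> = (SUP T::nat. \<integral>\<^sup>+z. \<integral>\<^sup>+w. truncated_kernel b T z w \<partial>\<nu> \<partial>\<nu>)"
    by (intro nn_integral_monotone_convergence_SUP tm3)
      (auto simp: incseq_def le_fun_def intro!: nn_integral_mono truncated_kernel_mono)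
  also have "\<dots> \<le> ennreal (b - a)" by (intro SUP_least trunc) simp
  finally have "enn2ereal (\<integral>\<^sup>+z. \<integral>\<^sup>+w. shifted_kernel b z w \<partial>\<nu> \<partial>\<nu>) \<le> ereal (b - a)"
    using ab by (metis diff_ge_0_iff_ge enn2ereal_ennreal less_eq_ennreal.rep_eq)
  then have "enn2ereal (\<integral>\<^sup>+z. \<integral>\<^sup>+w. shifted_kernel b z w \<partial>\<nu> \<partial>\<nu>) - ereal b \<le> ereal (b - a) - ereal b"
    by (rule ereal_minus_mono) simp
  then have "log_energy \<nu> \<le> ereal (b - a) - ereal b"
    using log_energy_eq_shifted[OF \<nu>_prob Lb b] by simp
  then show ?thesis using \<nu>_prob by auto
qed

lemma log_capacity_ge_of_point_sequence:
  assumes L: "compact L" and x: "\<And>i. x i \<in> L" "inj x"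
    and a: "\<And>n. real n * a \<le> (\<Sum>i<n. ln (cmod (x n - x i)))"
    and low: "min_log_energy L \<noteq> -\<infinity>"
  shows "log_capacity L \<ge> exp a"
proof -
  obtain \<nu> where \<nu>: "\<nu> \<in> prob_measures_on L" "log_energy \<nu> \<le> ereal (- a)"
    using ex_measure_small_energy[OF L x a] by blast
  then have "min_log_energy L \<le> ereal (- a)"
    unfolding min_log_energy_def by (meson INF_lower order_trans)
  then show ?thesis using low by (cases "min_log_energy L") (auto simp: log_capacity_def)
qed

section \<open>Chebyshev polynomials described by their roots\<close>

text \<open>Roots may be restricted to a disc that contains \<open>K\<close>: projecting a root to the disc
  brings it closer to every point of \<open>K\<close>. The set of admissible roots is then compact, and the
  sets of roots with norm at most \<open>c\<close>, for \<open>c\<close> above the infimum, are closed and have the finite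
  intersection property.\<close>

lemma ex_minimal_prod_roots:
  assumes K: "compact K" "K \<noteq> {}"
  obtains a :: "nat \<Rightarrow> complex" where
    "\<And>b. sup_norm K (\<lambda>z. \<Prod>i<n. z - a i) \<le> sup_norm K (\<lambda>z. \<Prod>i<n. z - b i)"
proof -
  obtain R where R: "R > 0" "\<And>z. z \<in> K \<Longrightarrow> cmod z \<le> R"
    using compact_imp_bounded[OF K(1)] unfolding bounded_pos by blast
  let ?p = "\<lambda>a z. cmod (\<Prod>i<n. z - a i)"
  define N where "N a = sup_norm K (\<lambda>z. \<Prod>i<n. z - a i)" for a :: "nat \<Rightarrow> complex"
  have bdd: "bdd_above (?p a ` K)" for a
    by (intro bounded_imp_bdd_above compact_imp_bounded compact_continuous_image continuous_intros K)
  have N_upper: "?p a z \<le> N a" if "z \<in> K" for a z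
    unfolding N_def sup_norm_def using that bdd by (rule cSUP_upper)
  have N_least: "N a \<le> c" if "\<And>z. z \<in> K \<Longrightarrow> ?p a z \<le> c" for a c
    unfolding N_def sup_norm_def using K(2) that by (rule cSUP_least)
  define D where "D = PiE UNIV (\<lambda>_::nat. cball (0::complex) R)"
  have "compactin (product_topology (\<lambda>_. euclidean) UNIV) D"
    unfolding D_def compactin_PiE by simp
  then have D: "compact D" by (simp add: euclidean_product_topology)
  have D0: "(\<lambda>_. 0) \<in> D" using R(1) by (simp add: D_def PiE_def extensional_def)
  define m where "m = Inf (N ` D)"
  have N0: "0 \<le> N a" for a
    using K(2) N_upper[of _ a] norm_ge_zero order_trans by (metis ex_in_conv)
  have bddN: "bdd_below (N ` D)" using N0 by (intro bdd_belowI[of _ 0]) auto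
  have cont: "continuous_on UNIV (\<lambda>a. ?p a z)" for z
    by (intro continuous_intros continuous_on_product_coordinates)
  have "closed {a. \<forall>z\<in>K. ?p a z \<le> c}" for c
  proof -
    have "{a. \<forall>z\<in>K. ?p a z \<le> c} = (\<Inter>z\<in>K. {a. ?p a z \<le> c})" by auto
    then show ?thesis using cont by (auto intro!: closed_INT closed_Collect_le continuous_intros)
  qed
  then have C_closed: "closed {a. \<forall>z\<in>K. ?p a z \<le> c}" for c .
  have "D \<inter> (\<Inter>c\<in>{m<..}. {a. \<forall>z\<in>K. ?p a z \<le> c}) \<noteq> {}"
  proof (rule compact_imp_fip_image[OF D])
    show "closed {a. \<forall>z\<in>K. ?p a z \<le> c}" for c by (rule C_closed)
    fix I :: "real set" assume I: "finite I" "I \<subseteq> {m<..}"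
    define c where "c = Min (insert (m + 1) I)"
    have c: "m < c" "\<And>c'. c' \<in> I \<Longrightarrow> c \<le> c'" using I unfolding c_def by (auto simp: subset_iff)
    obtain a where a: "a \<in> D" "N a < c"
      using c(1) D0 cInf_lessD[of "N ` D" c] unfolding m_def by auto
    have "?p a z \<le> c'" if "c' \<in> I" "z \<in> K" for c' z
      using N_upper[OF that(2), of a] a(2) c(2)[OF that(1)] by linarith
    then have "a \<in> D \<inter> (\<Inter>c\<in>I. {a. \<forall>z\<in>K. ?p a z \<le> c})" using a(1) by simp
    then show "D \<inter> (\<Inter>c\<in>I. {a. \<forall>z\<in>K. ?p a z \<le> c}) \<noteq> {}"
      by (rule iffD1[OF ex_in_conv, OF exI])
  qed
  from iffD2[OF ex_in_conv this]
  obtain a where a: "a \<in> D \<inter> (\<Inter>c\<in>{m<..}. {a. \<forall>z\<in>K. ?p a z \<le> c})" by (elim exE)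
  have below: "?p a z \<le> c" if "m < c" "z \<in> K" for c z
    using INT_D[OF IntD2[OF a], of c] that by simp
  have Na: "N a \<le> m" by (rule N_least, rule dense_ge, rule below)
  have "N a \<le> N b" for b
  proof -
    define b' where "b' i = closest_point (cball 0 R) (b i)" for i
    have ne: "cball (0::complex) R \<noteq> {}" using R(1) by simp
    have "b' \<in> D" unfolding D_def b'_def
      using closest_point_in_set[OF closed_cball ne] by auto
    then have "m \<le> N b'" unfolding m_def using bddN by (intro cInf_lower) auto
    also have "N b' \<le> N b"
    proof (rule N_least)
      fix z assume z: "z \<in> K"
      have "cmod (z - b' i) \<le> cmod (z - b i)" for i
      proof -
        have "z \<in> cball 0 R" using R(2)[OF z] by simp
        then have "dist (closest_point (cball 0 R) z) (b' i) \<le> dist z (b i)"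
          unfolding b'_def by (intro closest_point_lipschitz convex_cball closed_cball ne)
        then show ?thesis using \<open>z \<in> cball 0 R\<close> by (simp add: closest_point_self dist_norm)
      qed
      then have "?p b' z \<le> ?p b z" unfolding prod_norm[symmetric] by (intro prod_mono) auto
      also have "\<dots> \<le> N b" using z by (rule N_upper)
      finally show "?p b' z \<le> N b" .
    qed
    finally show ?thesis using Na by simp
  qed
  then show ?thesis using that unfolding N_def by blast
qed

lemma chebyshev_norm_prod_roots:
  assumes K: "compact K" "K \<noteq> {}"
  obtains a :: "nat \<Rightarrow> complex" where "chebyshev_norm K n = sup_norm K (\<lambda>z. \<Prod>i<n. z - a i)"
    "\<And>b. chebyshev_norm K n \<le> sup_norm K (\<lambda>z. \<Prod>i<n. z - b i)"
proof -
  obtain a where a: "\<And>b. sup_norm K (\<lambda>z. \<Prod>i<n. z - a i) \<le> sup_norm K (\<lambda>z. \<Prod>i<n. z - b i)"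
    using ex_minimal_prod_roots[OF K] by blast
  obtain P where P: "degree P = n" "lead_coeff P = 1" "\<And>z. poly P z = (\<Prod>i<n. z - a i)"
    by (rule prod_roots_monic_poly[of n a]) (rule that)
  let ?Q = "chebyshev_poly K n"
  have "is_arg_min (\<lambda>P. sup_norm K (poly P)) (\<lambda>P. degree P = n \<and> lead_coeff P = 1) P"
    unfolding is_arg_min_linorder
  proof (intro conjI allI impI P(1,2))
    fix Q :: "complex poly" assume "degree Q = n \<and> lead_coeff Q = 1"
    then obtain b where "\<And>z. poly Q z = (\<Prod>i<n. z - b i)" using monic_poly_eq_prod_roots by blast
    then have "poly Q = (\<lambda>z. \<Prod>i<n. z - b i)" "poly P = (\<lambda>z. \<Prod>i<n. z - a i)" using P(3) by auto
    then show "sup_norm K (poly P) \<le> sup_norm K (poly Q)" using a[of b] by simp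
  qed
  then have Q: "is_arg_min (\<lambda>P. sup_norm K (poly P)) (\<lambda>P. degree P = n \<and> lead_coeff P = 1) ?Q"
    unfolding chebyshev_poly_def arg_min_def by (rule someI)
  then have "degree ?Q = n" "lead_coeff ?Q = 1" unfolding is_arg_min_linorder by auto
  then obtain b where b: "\<And>z. poly ?Q z = (\<Prod>i<n. z - b i)"
    using monic_poly_eq_prod_roots by blast
  show ?thesis
  proof
    show "chebyshev_norm K n = sup_norm K (\<lambda>z. \<Prod>i<n. z - b i)"
      unfolding chebyshev_norm_def using b by presburger
    fix c :: "nat \<Rightarrow> complex"
    obtain P where "degree P = n" "lead_coeff P = 1" "\<And>z. poly P z = (\<Prod>i<n. z - c i)"
      by (rule prod_roots_monic_poly[of n c]) (rule that)
    then have "sup_norm K (poly ?Q) \<le> sup_norm K (poly P)" "poly P = (\<lambda>z. \<Prod>i<n. z - c i)"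
      using Q unfolding is_arg_min_linorder by auto
    then show "chebyshev_norm K n \<le> sup_norm K (\<lambda>z. \<Prod>i<n. z - c i)"
      unfolding chebyshev_norm_def by simp
  qed
qed

text \<open>Evaluate the extremal polynomial of \<open>K\<close> as a competitor on \<open>L\<close>.\<close>

lemma chebyshev_norm_le_of_growth:
  assumes K: "compact K" "K \<noteq> {}" and L: "compact L" "L \<noteq> {}" and c: "c \<ge> 0"
    and growth: "\<And>a M z. (\<And>w. w \<in> K \<Longrightarrow> cmod (\<Prod>i<n. w - a i) \<le> M) \<Longrightarrow> M \<ge> 0 \<Longrightarrow> z \<in> L \<Longrightarrow>
      cmod (\<Prod>i<n. z - a i) \<le> M * c"
  shows "chebyshev_norm L n \<le> chebyshev_norm K n * c"
proof -
  obtain a where a: "chebyshev_norm K n = sup_norm K (\<lambda>z. \<Prod>i<n. z - a i)"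
    using chebyshev_norm_prod_roots[OF K] by metis
  have bdd: "bdd_above ((\<lambda>z. cmod (\<Prod>i<n. z - a i)) ` K)"
    by (intro bounded_imp_bdd_above compact_imp_bounded compact_continuous_image continuous_intros K)
  have le: "cmod (\<Prod>i<n. w - a i) \<le> chebyshev_norm K n" if "w \<in> K" for w
    unfolding a sup_norm_def using that bdd by (rule cSUP_upper)
  then have "chebyshev_norm K n \<ge> 0" using K(2) norm_ge_zero order_trans by (metis ex_in_conv)
  have "chebyshev_norm L n \<le> sup_norm L (\<lambda>z. \<Prod>i<n. z - a i)"
    using chebyshev_norm_prod_roots[OF L] by metis
  also have "\<dots> \<le> chebyshev_norm K n * c"
    unfolding sup_norm_def using L(2)
    by (rule cSUP_least) (rule growth[OF le \<open>chebyshev_norm K n \<ge> 0\<close>])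
  finally show ?thesis .
qed

section \<open>Capacity and Chebyshev norms of the level curves\<close>

context green_level_sets
begin

text \<open>A Leja sequence: each point is chosen where the monic polynomial with the previous points as
  roots is large.\<close>

lemma ex_leja_points:
  assumes \<alpha>: "\<alpha> > 0"
  obtains x :: "nat \<Rightarrow> complex" where "\<And>i. x i \<in> level \<alpha>" "inj x"
    "\<And>n. real n * (\<tau> + \<alpha>) \<le> (\<Sum>i<n. ln (cmod (x n - x i)))"
proof -
  have "\<exists>z. z \<in> level \<alpha> \<and> exp (real n * (\<tau> + \<alpha>)) \<le> cmod (\<Prod>i<n. z - a i)" for n a
    by (rule prod_roots_large_on_level[OF \<alpha>, of n a]) blast
  then obtain f where f: "\<And>n a. f n a \<in> level \<alpha>"
    "\<And>n a. exp (real n * (\<tau> + \<alpha>)) \<le> cmod (\<Prod>i<n. f n a - a i)"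
    by metis
  \<comment> \<open>\<open>X n\<close> agrees with the sequence below \<open>n\<close>.\<close>
  define X where "X = rec_nat (\<lambda>_. 0) (\<lambda>n a. a(n := f n a))"
  have X: "X (Suc n) = (X n)(n := f n (X n))" for n by (simp add: X_def)
  define x where "x n = f n (X n)" for n
  have Xi: "X n i = x i" if "i < n" for n i
    using that by (induction n) (auto simp: X x_def less_Suc_eq)
  have prod: "exp (real n * (\<tau> + \<alpha>)) \<le> cmod (\<Prod>i<n. x n - x i)" for n
    using f(2)[of n "X n"] Xi by (simp add: x_def)
  have ne: "x n \<noteq> x i" if "i < n" for n i
  proof
    assume "x n = x i"
    then have "(\<Prod>i<n. x n - x i) = 0" using that by (intro prod_zero) auto
    then show False using prod[of n] by (metis norm_zero exp_gt_zero not_le)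
  qed
  show ?thesis
  proof
    show "x i \<in> level \<alpha>" for i using f(1) by (simp add: x_def)
    show "inj x" using ne by (metis injI linorder_neqE_nat)
    show "real n * (\<tau> + \<alpha>) \<le> (\<Sum>i<n. ln (cmod (x n - x i)))" for n
      using prod[of n] ne[of _ n] norm_prod_eq_exp_sum_ln[of "{..<n}" "x n" x] by simp
  qed
qed

text \<open>The small polynomial comes from the level \<open>\<alpha> + \<epsilon>\<close> with error \<open>\<epsilon>\<close>, whence the \<open>2 \<epsilon>\<close>. The
  first claim guards against the value that \<open>log_capacity\<close> takes when the minimal energy is
  \<open>-\<infinity>\<close>.\<close>

lemma capacity_sublevel_le:
  assumes \<alpha>: "\<alpha> \<ge> 0" and K: "compact K" "\<And>z. z \<in> K \<Longrightarrow> G z \<le> \<alpha>"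
  shows "min_log_energy K \<noteq> -\<infinity>" "log_capacity K \<le> exp (\<tau> + \<alpha>)"
proof -
  have *: "min_log_energy K \<noteq> -\<infinity> \<and> log_capacity K \<le> exp (\<tau> + \<alpha> + 2 * \<epsilon>)" if \<epsilon>: "\<epsilon> > 0" for \<epsilon>
  proof -
    let ?A = "exp (\<tau> + (\<alpha> + \<epsilon>) + \<epsilon>)"
    obtain N w where w: "N \<ge> 1"
      "\<And>z. G z \<le> \<alpha> \<Longrightarrow> cmod (\<Prod>i<N. z - w i) \<le> exp (real N * (\<tau> + (\<alpha> + \<epsilon>) + \<epsilon>))"
      using small_poly_on_sublevel[OF \<alpha> _ \<epsilon>, of "\<alpha> + \<epsilon>"] \<epsilon> by auto
    obtain P where P: "degree P = N" "lead_coeff P = 1" "\<And>z. poly P z = (\<Prod>i<N. z - w i)"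
      by (rule prod_roots_monic_poly[of N w]) (rule that)
    have "cmod (poly P z) \<le> ?A ^ N" if "z \<in> K" for z
      using w(2)[OF K(2)[OF that]] by (simp add: P(3) exp_of_nat_mult[symmetric])
    from monic_polys_of_all_degrees[OF P(1) w(1) P(2) this compact_imp_bounded[OF K(1)] exp_gt_zero]
    obtain B where B: "B > 0" "\<And>k. \<exists>q :: complex poly. degree q = k \<and> lead_coeff q = 1 \<and>
      (\<forall>z\<in>K. cmod (poly q z) \<le> B * ?A ^ k)" by metis
    from log_capacity_le_of_small_polys[OF K(1) B(2) exp_gt_zero B(1)] show ?thesis
      by (auto simp: algebra_simps)
  qed
  from *[of 1] show "min_log_energy K \<noteq> -\<infinity>" by simp
  have "((\<lambda>\<epsilon>. exp (\<tau> + \<alpha> + 2 * \<epsilon>)) \<longlongrightarrow> exp (\<tau> + \<alpha> + 2 * 0)) (at_right 0)"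
    by (intro tendsto_intros)
  moreover have "\<forall>\<^sub>F \<epsilon> in at_right 0. log_capacity K \<le> exp (\<tau> + \<alpha> + 2 * \<epsilon>)"
    using * by (auto simp: eventually_at_right_field intro!: exI[of _ 1])
  ultimately have "log_capacity K \<le> exp (\<tau> + \<alpha> + 2 * 0)"
    by (rule tendsto_lowerbound) simp
  then show "log_capacity K \<le> exp (\<tau> + \<alpha>)" by simp
qed

lemma capacity_level:
  assumes \<alpha>: "\<alpha> > 0"
  shows "log_capacity (level \<alpha>) = exp (\<tau> + \<alpha>)"
proof (rule antisym)
  note upper = capacity_sublevel_le[OF less_imp_le[OF \<alpha>] compact_level[of \<alpha>]]
  show "log_capacity (level \<alpha>) \<le> exp (\<tau> + \<alpha>)" by (rule upper) simp
  obtain x where "\<And>i. x i \<in> level \<alpha>" "inj x"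
    "\<And>n. real n * (\<tau> + \<alpha>) \<le> (\<Sum>i<n. ln (cmod (x n - x i)))"
    using ex_leja_points[OF \<alpha>] by blast
  moreover have "min_log_energy (level \<alpha>) \<noteq> -\<infinity>" by (rule upper) simp
  ultimately show "exp (\<tau> + \<alpha>) \<le> log_capacity (level \<alpha>)"
    by (intro log_capacity_ge_of_point_sequence[OF compact_level])
qed

lemma level_nonempty: "\<alpha> > 0 \<Longrightarrow> level \<alpha> \<noteq> {}"
  using infinite_level by (metis infinite_imp_nonempty)

lemma widom_factor_level_antimono:
  assumes "0 < \<alpha>" "\<alpha> \<le> \<beta>"
  shows "widom_factor (level \<beta>) n \<le> widom_factor (level \<alpha>) n"
proof -
  have \<beta>: "\<beta> > 0" using assms by simp
  have "chebyshev_norm (level \<beta>) n \<le> chebyshev_norm (level \<alpha>) n * exp (real n * (\<beta> - \<alpha>))"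
  proof (rule chebyshev_norm_le_of_growth)
    fix a M z
    assume "\<And>w. w \<in> level \<alpha> \<Longrightarrow> cmod (\<Prod>i<n. w - a i) \<le> M" "M \<ge> 0" "z \<in> level \<beta>"
    then show "cmod (\<Prod>i<n. z - a i) \<le> M * exp (real n * (\<beta> - \<alpha>))"
      using bernstein_walsh_level[OF assms(1), where n = n and a = a and M = M and z = z] assms(2) by auto
  qed (use compact_level level_nonempty assms(1) \<beta> in auto)
  also have "exp (real n * (\<beta> - \<alpha>)) = log_capacity (level \<beta>) ^ n / log_capacity (level \<alpha>) ^ n"
    by (simp add: capacity_level assms(1) \<beta> exp_of_nat_mult[symmetric] exp_diff[symmetric])
      (simp add: algebra_simps)
  finally show ?thesis
    using capacity_level[OF \<beta>] capacity_level[OF assms(1)]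
    by (simp add: widom_factor_def field_simps)
qed

text \<open>Degree \<open>0\<close> of the hypothesis shows \<open>Q \<ge> 1\<close>, so that replacing the capacity of \<open>e\<close> by its upper bound \<open>exp \<tau>\<close>
  only enlarges the right-hand side.\<close>

lemma totik_widom_bound_level:
  assumes Q: "totik_widom_bound e Q" and \<alpha>: "\<alpha> > 0"
  shows "totik_widom_bound (level \<alpha>) Q"
  unfolding totik_widom_bound_def
proof
  fix n
  have cap: "0 \<le> log_capacity e" "log_capacity e \<le> exp \<tau>"
    using capacity_sublevel_le(2)[of 0 e] compact_e G_zero by (auto simp: log_capacity_def)
  obtain a where "chebyshev_norm e 0 = sup_norm e (\<lambda>z. \<Prod>i<(0::nat). z - a i)"
    by (rule chebyshev_norm_prod_roots[OF compact_e nonempty_e, where n = 0]) (rule that)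
  then have "chebyshev_norm e 0 = 1" using nonempty_e by (simp add: sup_norm_def)
  then have Q1: "1 \<le> Q" using Q by (auto simp: totik_widom_bound_def dest: spec[of _ 0])
  have "chebyshev_norm (level \<alpha>) n \<le> chebyshev_norm e n * exp (real n * \<alpha>)"
  proof (rule chebyshev_norm_le_of_growth)
    fix a M z
    assume "\<And>w. w \<in> e \<Longrightarrow> cmod (\<Prod>i<n. w - a i) \<le> M" "M \<ge> 0" "z \<in> level \<alpha>"
    then show "cmod (\<Prod>i<n. z - a i) \<le> M * exp (real n * \<alpha>)"
      using bernstein_walsh_e[where n = n and a = a and M = M and z = z] by auto
  qed (use compact_level level_nonempty \<alpha> compact_e nonempty_e in auto)
  also have "\<dots> \<le> (Q * log_capacity e ^ n) * exp (real n * \<alpha>)"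
    using Q by (intro mult_right_mono) (auto simp: totik_widom_bound_def)
  also have "\<dots> \<le> (Q * exp \<tau> ^ n) * exp (real n * \<alpha>)"
    using cap Q1 by (intro mult_right_mono mult_left_mono power_mono) auto
  also have "\<dots> = Q * log_capacity (level \<alpha>) ^ n"
    using \<alpha> by (simp add: capacity_level exp_of_nat_mult[symmetric] exp_add[symmetric] mult.assoc)
      (simp add: algebra_simps)
  finally show "chebyshev_norm (level \<alpha>) n \<le> Q * log_capacity (level \<alpha>) ^ n" .
qed

end

lemma outside_eq_Compl:
  fixes e :: "complex set"
  assumes "bounded e" "connected (- e)"
  shows "outside e = - e"
proof -
  have "\<not> bounded (- e)" using assms(1) by (metis bounded_Un cobounded_imp_unbounded compl_sup_top double_complement)
  moreover have "connected_component_set (- e) z = - e" if "z \<notin> e" for z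
    using connected_component_eq_self[OF assms(2)] that by auto
  ultimately show ?thesis by (auto simp: outside_def)
qed

lemma log_capacity_empty: "log_capacity {} = 0"
proof -
  have "prob_measures_on {} = {}" by (auto simp: prob_measures_on_def)
  then show ?thesis by (simp add: log_capacity_def min_log_energy_def top_ereal_def)
qed

text \<open>Regularity is needed for the continuity of \<open>G\<close> at boundary points of \<open>e\<close>; at interior points
  \<open>G\<close> is locally constant.\<close>

lemma green_level_sets_of_regular:
  assumes e: "compact e" "connected (- e)" "potential_regular e" "is_green_function e G"
  shows "green_level_sets e G"
proof
  have out: "outside e = - e" using outside_eq_Compl[OF compact_imp_bounded] e by blast
  have closed: "closed e" using e(1) by (rule compact_imp_closed)
  have harm: "harmonic_function_on (- e) G" and zero: "\<And>z. z \<in> e \<Longrightarrow> G z = 0"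
    and O: "(\<lambda>z. G z - ln (cmod z)) \<in> O[at_infinity](\<lambda>_. 1)"
    using e(4) out unfolding is_green_function_def by auto
  have bdry: "(G \<longlongrightarrow> 0) (at \<zeta> within - e)" if "\<zeta> \<in> frontier e" for \<zeta>
    using e(3,4) that out unfolding potential_regular_def by (auto simp: frontier_complement)
  show "compact e" by fact
  show "e \<noteq> {}" using e(3) log_capacity_empty by (auto simp: potential_regular_def)
  show "has_laplacian G 0 z" if "z \<notin> e" for z
    using harmonic_function_on_has_laplacian[OF harm] that by simp
  show "G z = 0" if "z \<in> e" for z using zero that .
  show "\<exists>C. \<forall>\<^sub>F z in at_infinity. \<bar>G z - ln (cmod z)\<bar> \<le> C"
  proof -
    obtain c where "\<forall>\<^sub>F z in at_infinity. norm (G z - ln (cmod z)) \<le> c * norm (1::real)"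
      by (rule landau_o.bigE[OF O]) (rule that)
    then show ?thesis by (intro exI[of _ c]) simp
  qed
  have "isCont G z" for z
  proof (cases "z \<in> e")
    case False
    then obtain a b where "(G has_derivative (\<lambda>h. a * Re h + b * Im h)) (at z)"
      using harm unfolding harmonic_function_on_def by blast
    then show ?thesis by (rule has_derivative_continuous)
  next
    case True
    have 1: "(G \<longlongrightarrow> 0) (at z within e)"
      by (rule Lim_transform_eventually[OF tendsto_const[of 0]])
        (auto simp: eventually_at_filter zero)
    show ?thesis
    proof (cases "z \<in> interior e")
      case True
      then have "at z within e = at z" by (rule at_within_interior)
      then show ?thesis using 1 unfolding isCont_def zero[OF \<open>z \<in> e\<close>] by (simp only:)
    next
      case False
      then have "z \<in> frontier e" using True closed by (simp add: frontier_def)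
      then have "(G \<longlongrightarrow> 0) (at z within e \<union> - e)" by (intro Lim_Un 1 bdry)
      then show ?thesis using zero[OF True] by (simp add: isCont_def)
    qed
  qed
  then show "continuous_on UNIV G" by (simp add: continuous_on_eq_continuous_at)
qed

theorem theorem1p5:
  fixes e :: "complex set" and G :: "complex \<Rightarrow> real"
  assumes "compact e"
    and "connected (- e)"
    and "potential_regular e"
    and "is_green_function e G"
  shows "(\<forall>n \<alpha> \<beta>. 0 < \<alpha> \<and> \<alpha> \<le> \<beta> \<longrightarrow>
            widom_factor {z. G z = \<beta>} n \<le> widom_factor {z. G z = \<alpha>} n) \<and>
         (\<forall>Q. totik_widom_bound e Q \<longrightarrow>
            (\<forall>\<alpha>>0. totik_widom_bound {z. G z = \<alpha>} Q))"
proof -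
  interpret green_level_sets e G using assms by (rule green_level_sets_of_regular)
  show ?thesis using widom_factor_level_antimono totik_widom_bound_level by blast
qed

end
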